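(* Let $M>1$ and $R>0$. There exists a constant $C>0$ depending on $M,R$ (and the dimension $n$) such that for any $M$-uniform domain $\Omega\subset\mathbb{R}^n$ contained in $B_R$, $$\int_\Omega u^2\,dx\le C\int_\Omega|\nabla u|^2\,dx\qquad\text{for all } u\in H^1(\Omega)\text{ with }\int_\Omega u\,dx=0 .$$
   Context: $B_R$ is the ball of radius $R$ in $\mathbb{R}^n$ centered at the origin. A domain is a (nonempty) connected open set. For $M>1$, a domain $\Omega\subset\mathbb{R}^n$ is called an $M$-uniform domain if for any $x_1,x_2\in\overline{\Omega}$ there is a rectifiable curve $\gamma:[0,1]\to\overline{\Omega}$ with $\gamma(0)=x_1$, $\gamma(1)=x_2$, such that (i) $\mathscr{H}^1(\gamma)\le M|x_1-x_2|$ and (ii) $d(\gamma(t),\partial\Omega)\ge \frac1M\min\{|\gamma(t)-x_1|,|\gamma(t)-x_2|\}$ for all $t\in[0,1]$. Here $\mathscr{H}^1$ is one-dimensional Hausdorff measure. *)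

theory Defs
  imports "HOL-Analysis.Analysis"
begin

section \<open>Rectifiable curves and one-dimensional Hausdorff measure\<close>

definition rectifiable_path :: "(real \<Rightarrow> 'a::metric_space) \<Rightarrow> bool" where
  "rectifiable_path \<gamma> \<longleftrightarrow> path \<gamma> \<and>
     (\<exists>L. \<forall>n (t :: nat \<Rightarrow> real). mono_on {..n} t \<and> t ` {..n} \<subseteq> {0..1} \<longrightarrow>
        (\<Sum>i<n. dist (\<gamma> (t i)) (\<gamma> (t (Suc i)))) \<le> L)"

text \<open>
  Covering sets are required to be bounded because \<^const>\<open>diameter\<close> is real-valued and carries no
  information for unbounded sets. Finite covers are included, as covering sets may be empty.
  The normalisation constant of one-dimensional Hausdorff measure is 1.
\<close>

definition hausdorff1_premeasure :: "real \<Rightarrow> 'a::metric_space set \<Rightarrow> ennreal" where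
  "hausdorff1_premeasure \<delta> A =
     (INF U \<in> {U :: nat \<Rightarrow> 'a set. (\<forall>i. bounded (U i) \<and> diameter (U i) \<le> \<delta>) \<and> A \<subseteq> (\<Union>i. U i)}.
        \<Sum>i. ennreal (diameter (U i)))"

definition hausdorff1 :: "'a::metric_space set \<Rightarrow> ennreal" where
  "hausdorff1 A = (SUP \<delta> \<in> {0<..}. hausdorff1_premeasure \<delta> A)"

section \<open>Uniform domains\<close>

definition is_domain :: "'a::topological_space set \<Rightarrow> bool" where
  "is_domain \<Omega> \<longleftrightarrow> open \<Omega> \<and> connected \<Omega> \<and> \<Omega> \<noteq> {}"

text \<open>
  The distance to an empty boundary is taken to be infinite, whereas \<^const>\<open>infdist\<close> to the empty
  set is 0; hence the disjunction. It only matters when the domain is the whole space.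
\<close>

definition uniform_domain :: "real \<Rightarrow> 'a::euclidean_space set \<Rightarrow> bool" where
  "uniform_domain M \<Omega> \<longleftrightarrow> M > 1 \<and> is_domain \<Omega> \<and>
     (\<forall>x1 \<in> closure \<Omega>. \<forall>x2 \<in> closure \<Omega>. \<exists>\<gamma>.
        rectifiable_path \<gamma> \<and> path_image \<gamma> \<subseteq> closure \<Omega> \<and>
        pathstart \<gamma> = x1 \<and> pathfinish \<gamma> = x2 \<and>
        hausdorff1 (path_image \<gamma>) \<le> ennreal (M * dist x1 x2) \<and>
        (\<forall>t \<in> {0..1}. frontier \<Omega> = {} \<or>
           infdist (\<gamma> t) (frontier \<Omega>) \<ge> 1 / M * min (dist (\<gamma> t) x1) (dist (\<gamma> t) x2)))"

section \<open>The Sobolev space \<open>H\<^sup>1\<close>\<close>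

abbreviation partial_deriv :: "'a::euclidean_space \<Rightarrow> ('a \<Rightarrow> real) \<Rightarrow> 'a \<Rightarrow> real" where
  "partial_deriv b f x \<equiv> frechet_derivative f (at x) b"

primrec C_k :: "nat \<Rightarrow> ('a::euclidean_space \<Rightarrow> real) \<Rightarrow> bool" where
  "C_k 0 f \<longleftrightarrow> continuous_on UNIV f"
| "C_k (Suc k) f \<longleftrightarrow>
     (\<forall>x. f differentiable (at x)) \<and> (\<forall>b \<in> Basis. C_k k (partial_deriv b f))"

definition test_function :: "'a::euclidean_space set \<Rightarrow> ('a \<Rightarrow> real) \<Rightarrow> bool" where
  "test_function \<Omega> \<phi> \<longleftrightarrow>
     (\<forall>k. C_k k \<phi>) \<and> compact (closure {x. \<phi> x \<noteq> 0}) \<and> closure {x. \<phi> x \<noteq> 0} \<subseteq> \<Omega>"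

text \<open>
  Elements of the function spaces are represented by total functions whose values outside
  \<open>\<Omega>\<close> are irrelevant; almost-everywhere equal functions are not identified.
\<close>

definition square_integrable :: "'a::euclidean_space set \<Rightarrow> ('a \<Rightarrow> 'b::euclidean_space) \<Rightarrow> bool" where
  "square_integrable \<Omega> f \<longleftrightarrow>
     f \<in> borel_measurable (lebesgue_on \<Omega>) \<and> integrable (lebesgue_on \<Omega>) (\<lambda>x. (norm (f x))\<^sup>2)"

definition L2_weak_gradient :: "'a::euclidean_space set \<Rightarrow> ('a \<Rightarrow> real) \<Rightarrow> ('a \<Rightarrow> 'a) \<Rightarrow> bool" where
  "L2_weak_gradient \<Omega> u g \<longleftrightarrow> square_integrable \<Omega> g \<and>
     (\<forall>\<phi>. test_function \<Omega> \<phi> \<longrightarrow> (\<forall>b \<in> Basis.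
        (LINT x|lebesgue_on \<Omega>. u x * partial_deriv b \<phi> x) =
        - (LINT x|lebesgue_on \<Omega>. (g x \<bullet> b) * \<phi> x)))"

definition H1 :: "'a::euclidean_space set \<Rightarrow> ('a \<Rightarrow> real) set" where
  "H1 \<Omega> = {u. square_integrable \<Omega> u \<and> (\<exists>g. L2_weak_gradient \<Omega> u g)}"

end

theory Submission
  imports Defs
begin

text \<open>
  The proof compares the values of \<open>u\<close> at two points \<open>x\<close> and \<open>y\<close> of a uniform domain \<open>\<Omega>\<close> by means of smooth
  averages over cubes. Let \<open>F (p, r)\<close> be the average of \<open>u\<close> over the cube with corner \<open>p\<close> and side \<open>r\<close>, against a
  rescaled smooth bump. Moving the cube transports the bump by a continuity equation
  (\<open>mollifier_transport\<close>), so the definition of the weak gradient expresses the derivative of \<open>F\<close> in \<open>p\<close> and in \<open>r\<close>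
  as an average of \<open>Du\<close> over the same cube (\<open>mollify_segment_bound\<close>).

  Take a uniform curve from \<open>x\<close> to \<open>y\<close>, and at each of its points \<open>p\<close> the cube whose side is a small multiple of
  \<open>min \<bar>p - x\<bar> \<bar>p - y\<bar>\<close> plus \<open>\<epsilon>\<close>. By the cigar condition these cubes lie well inside \<open>\<Omega>\<close>
  (\<open>uniform_domain_connected_family\<close>). Sort them by their side into dyadic scales. Up to scaling, the cubes of side
  about \<open>s\<close> that belong to the end \<open>x\<close> form a precompact family, so finitely many cells, their number
  independent of \<open>s\<close>, suffice to cover it; on each cell \<open>F\<close> varies by at most a constant times
  \<open>s / s ^ n\<close> times the integral of \<open>\<bar>Du\<bar>\<close> over a ball around \<open>x\<close> of radius comparable to \<open>s\<close>
  (\<open>mollify_shell_image\<close>). The values of \<open>F\<close> along the curve form an interval, and the length of an interval is at most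
  the sum of the lengths of the intervals that cover it. Hence
  \<open>\<bar>F (x, \<epsilon>) - F (y, \<epsilon>)\<bar> \<le> H x + H y\<close>, where \<open>H\<close> is a Riesz-type potential of \<open>\<bar>Du\<bar>\<close>
  (\<open>mollify_difference_bound\<close>). However often the curve returns to a cell, the cell is counted once.

  Letting \<open>\<epsilon>\<close> tend to 0, Lebesgue differentiation gives \<open>\<bar>u x - u y\<bar> \<le> H x + H y\<close> for almost all \<open>x\<close> and \<open>y\<close>
  (\<open>two_point_estimate\<close>). The kernel of the potential has finite integral \<open>K\<close>, depending on \<open>M\<close>, \<open>R\<close> and \<open>n\<close>,
  so Young's inequality bounds the integral of \<open>H\<^sup>2\<close> by \<open>K\<^sup>2\<close> times that of \<open>\<bar>Du\<bar>\<^sup>2\<close>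
  (\<open>young_convolution_L1_L2\<close>). Finally, as \<open>u\<close> has mean zero, \<open>\<bar>u x\<bar>\<close> is at most \<open>H x\<close> plus the mean of \<open>H\<close>
  over \<open>\<Omega>\<close>, and the integral of \<open>u\<^sup>2\<close> is at most four times that of \<open>H\<^sup>2\<close> (\<open>mean_zero_L2_bound\<close>).
\<close>

section \<open>Calculus of smooth functions\<close>

lemma frechet_derivative_eq: "(f has_derivative f') (at x) \<Longrightarrow> frechet_derivative f (at x) = f'"
  by (metis frechet_derivative_at)

lemma C_k_const: "C_k k (\<lambda>x. c)"
  by (induction k arbitrary: c) (auto simp: frechet_derivative_const)

lemma C_k_Suc_imp: "C_k (Suc k) f \<Longrightarrow> C_k k f"
proof (induction k arbitrary: f)
  case 0
  then show ?case
    by (auto simp: continuous_on_eq_continuous_within differentiable_imp_continuous_within)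
next
  case (Suc k)
  then show ?case by (metis C_k.simps(2))
qed

lemma C_k_add: "C_k k f \<Longrightarrow> C_k k g \<Longrightarrow> C_k k (\<lambda>x. f x + g x)"
proof (induction k arbitrary: f g)
  case 0
  then show ?case by (auto intro: continuous_intros)
next
  case (Suc k)
  have "partial_deriv b (\<lambda>x. f x + g x) = (\<lambda>x. partial_deriv b f x + partial_deriv b g x)" for b
  proof
    fix x
    have "(f has_derivative frechet_derivative f (at x)) (at x)"
      "(g has_derivative frechet_derivative g (at x)) (at x)"
      using Suc.prems by (simp_all add: frechet_derivative_works[symmetric])
    from frechet_derivative_eq[OF has_derivative_add[OF this]]
    show "partial_deriv b (\<lambda>x. f x + g x) x = partial_deriv b f x + partial_deriv b g x" by simp
  qed
  with Suc show ?case by auto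
qed

lemma C_k_mult: "C_k k f \<Longrightarrow> C_k k g \<Longrightarrow> C_k k (\<lambda>x. f x * g x)"
proof (induction k arbitrary: f g)
  case 0
  then show ?case by (auto intro: continuous_intros)
next
  case (Suc k)
  have "partial_deriv b (\<lambda>x. f x * g x) = (\<lambda>x. f x * partial_deriv b g x + partial_deriv b f x * g x)" for b
  proof
    fix x
    have "(f has_derivative frechet_derivative f (at x)) (at x)"
      "(g has_derivative frechet_derivative g (at x)) (at x)"
      using Suc.prems by (simp_all add: frechet_derivative_works[symmetric])
    from frechet_derivative_eq[OF has_derivative_mult[OF this]]
    show "partial_deriv b (\<lambda>x. f x * g x) x = f x * partial_deriv b g x + partial_deriv b f x * g x"
      by simp
  qed
  with Suc C_k_Suc_imp[OF Suc.prems(1)] C_k_Suc_imp[OF Suc.prems(2)] show ?case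
    by (auto intro!: C_k_add)
qed

lemma C_k_inner: "C_k k (\<lambda>x. x \<bullet> v)"
proof (cases k)
  case (Suc m)
  have D: "((\<lambda>x. x \<bullet> v) has_derivative (\<lambda>h. h \<bullet> v)) (at x)" for x
    by (auto intro!: derivative_eq_intros)
  show ?thesis
    unfolding Suc using D by (auto simp: frechet_derivative_eq[OF D] C_k_const differentiable_def)
qed (auto intro: continuous_intros)

lemma C_k_inner_self: "C_k k (\<lambda>x. x \<bullet> x)"
proof (cases k)
  case (Suc m)
  have D: "((\<lambda>x::'a. x \<bullet> x) has_derivative (\<lambda>h. 2 * (x \<bullet> h))) (at x)" for x
    by (auto intro!: derivative_eq_intros simp: inner_commute)
  show ?thesis
    unfolding Suc using D
    by (auto simp: frechet_derivative_eq[OF D] C_k_const C_k_inner C_k_mult differentiable_def)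
qed (auto intro: continuous_intros)

lemma partial_deriv_rescale:
  fixes f :: "'a::euclidean_space \<Rightarrow> real"
  assumes "\<And>x. f differentiable (at x)"
  shows "(\<lambda>y. f (s *\<^sub>R (y - p))) differentiable (at x)"
    and "partial_deriv b (\<lambda>y. f (s *\<^sub>R (y - p))) x = s * partial_deriv b f (s *\<^sub>R (x - p))"
proof -
  have f: "(f has_derivative frechet_derivative f (at z)) (at z)" for z
    using assms frechet_derivative_works by blast
  have D: "((\<lambda>y. f (s *\<^sub>R (y - p))) has_derivative
      (\<lambda>h. frechet_derivative f (at (s *\<^sub>R (x - p))) (s *\<^sub>R h))) (at x)"
    by (rule derivative_eq_intros has_derivative_compose[OF _ f] refl)+ simp
  then show "(\<lambda>y. f (s *\<^sub>R (y - p))) differentiable (at x)"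
    by (auto simp: differentiable_def)
  have "linear (frechet_derivative f (at (s *\<^sub>R (x - p))))"
    using f has_derivative_linear by blast
  then show "partial_deriv b (\<lambda>y. f (s *\<^sub>R (y - p))) x = s * partial_deriv b f (s *\<^sub>R (x - p))"
    by (simp add: frechet_derivative_eq[OF D] linear_scale)
qed

lemma C_k_rescale: "C_k k f \<Longrightarrow> C_k k (\<lambda>y. f (s *\<^sub>R (y - p)))"
proof (induction k arbitrary: f)
  case 0
  have "continuous_on UNIV (f \<circ> (\<lambda>y. s *\<^sub>R (y - p)))"
    by (rule continuous_on_compose) (use 0 in \<open>auto intro!: continuous_intros elim: continuous_on_subset\<close>)
  then show ?case by (simp add: o_def)
next
  case (Suc k)
  then show ?case
    by (auto simp: partial_deriv_rescale intro!: C_k_mult C_k_const)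
qed

section \<open>A smooth bump on the unit cube\<close>

text \<open>
  The parameter \<open>j\<close> makes the family of functions \<open>exp (- 1 / t) / t ^ j\<close>, extended by zero to
  \<open>t \<le> 0\<close>, closed under differentiation up to linear combinations. Smoothness of every member then
  follows by one induction over the order of differentiability, for all \<open>j\<close> at the same time.
\<close>

definition flat :: "nat \<Rightarrow> real \<Rightarrow> real" where
  "flat j t = (if t > 0 then exp (- 1 / t) / t ^ j else 0)"

text \<open>
  The exponential beats every power, so that difference quotients at the gluing point \<open>0\<close> vanish in the limit.
\<close>

lemma flat_tendsto_0: "((\<lambda>t::real. exp (- 1 / t) / t ^ j) \<longlongrightarrow> 0) (at_right 0)"
proof -
  have "((\<lambda>x::real. x ^ j / exp x) \<longlongrightarrow> 0) at_top"
    by (rule tendsto_power_div_exp_0)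
  then have "((\<lambda>x::real. inverse x ^ j / exp (inverse x)) \<longlongrightarrow> 0) (at_right 0)"
    using filterlim_compose filterlim_inverse_at_top_right by blast
  then show ?thesis
    by (rule Lim_transform_eventually)
      (auto simp: eventually_at_filter field_simps exp_minus power_inverse inverse_eq_divide)
qed

lemma flat_has_derivative:
  "(flat j has_real_derivative (flat (j + 2) t - real j * flat (j + 1) t)) (at t)"
proof -
  consider "t > 0" | "t < 0" | "t = 0" by linarith
  then show ?thesis
  proof cases
    case 1
    have "((\<lambda>t. exp (- 1 / t) / t ^ j) has_real_derivative
        (flat (j + 2) t - real j * flat (j + 1) t)) (at t)"
      using 1 by (auto intro!: derivative_eq_intros simp: flat_def power2_eq_square)
        (cases j; simp add: field_simps power2_eq_square)
    then show ?thesis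
      by (rule has_field_derivative_transform_within_open[where S="{0<..}"]) (use 1 in \<open>auto simp: flat_def\<close>)
  next
    case 2
    have "((\<lambda>t. 0) has_real_derivative 0) (at t)" by simp
    then have "(flat j has_real_derivative 0) (at t)"
      by (rule has_field_derivative_transform_within_open[where S="{..<0}"]) (use 2 in \<open>auto simp: flat_def\<close>)
    with 2 show ?thesis by (simp add: flat_def)
  next
    case 3
    have "((\<lambda>h. flat j h / h) \<longlongrightarrow> 0) (at 0)"
    proof (rule filterlim_split_at_real)
      show "((\<lambda>h. flat j h / h) \<longlongrightarrow> 0) (at_left 0)"
        by (rule tendsto_eventually) (auto simp: eventually_at_filter flat_def)
      show "((\<lambda>h. flat j h / h) \<longlongrightarrow> 0) (at_right 0)"
        by (rule Lim_transform_eventually[OF flat_tendsto_0[of "Suc j"]])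
          (auto simp: eventually_at_filter flat_def)
    qed
    with 3 show ?thesis by (simp add: has_field_derivative_iff flat_def)
  qed
qed

lemma C_k_flat_compose:
  fixes q :: "'a::euclidean_space \<Rightarrow> real"
  assumes "\<And>k. C_k k q"
  shows "C_k k (\<lambda>x. flat j (q x))"
proof (induction k arbitrary: j)
  case 0
  have "continuous_on UNIV (flat j)"
    by (meson DERIV_isCont continuous_at_imp_continuous_on flat_has_derivative)
  then have "continuous_on UNIV (flat j \<circ> q)"
    using assms[of 0] continuous_on_compose continuous_on_subset by (metis C_k.simps(1) subset_UNIV)
  then show ?case by (simp add: o_def)
next
  case (Suc k)
  let ?d = "\<lambda>x. flat (j + 2) (q x) + (- real j) * flat (j + 1) (q x)"
  have q: "(q has_derivative frechet_derivative q (at x)) (at x)" for x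
    using assms[of 1] frechet_derivative_works by auto
  have D: "((\<lambda>x. flat j (q x)) has_derivative (\<lambda>h. ?d x * frechet_derivative q (at x) h)) (at x)" for x
    using has_derivative_compose[OF q flat_has_derivative[unfolded has_field_derivative_def]]
    by simp
  have "C_k k (\<lambda>x. ?d x * partial_deriv b q x)" if "b \<in> Basis" for b
    using Suc[of "j + 2"] Suc[of "j + 1"] assms[of "Suc k"] that
    by (intro C_k_mult C_k_add C_k_const) auto
  with D show ?case
    by (auto simp: frechet_derivative_eq[OF D] differentiable_def)
qed

text \<open>
  The bump lives on the ball of radius \<open>1 / 2\<close> around the centre of the unit cube. The cube has the
  origin as a corner, and not as its centre, because Lebesgue differentiation is available for the one-sided
  cubes \<open>cbox x (x + h *\<^sub>R One)\<close>; see \<open>mollify_tendsto_AE\<close>.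
\<close>

definition bump :: "'a::euclidean_space \<Rightarrow> real" where
  "bump z = flat 0 (1 / 4 - (z - One /\<^sub>R 2) \<bullet> (z - One /\<^sub>R 2))"

lemma bump_smooth: "C_k k bump"
proof -
  have "C_k k (\<lambda>z::'a. (z - One /\<^sub>R 2) \<bullet> (z - One /\<^sub>R 2))" for k
    using C_k_rescale[OF C_k_inner_self, of k 1 "One /\<^sub>R 2"] by simp
  then have "C_k k (\<lambda>z::'a. 1 / 4 + (-1) * ((z - One /\<^sub>R 2) \<bullet> (z - One /\<^sub>R 2)))" for k
    by (intro C_k_add C_k_mult C_k_const)
  from C_k_flat_compose[OF this, of k 0] show ?thesis
    by (simp add: bump_def[abs_def])
qed

lemma bump_nonneg: "0 \<le> bump z"
  by (simp add: bump_def flat_def)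

lemma bump_eq_0: "bump z = 0" if "z \<notin> cbox 0 One" for z :: "'a::euclidean_space"
proof (rule ccontr)
  assume "bump z \<noteq> 0"
  then have "(z - One /\<^sub>R 2) \<bullet> (z - One /\<^sub>R 2) < 1 / 4"
    by (auto simp: bump_def flat_def split: if_splits)
  then have *: "norm (z - One /\<^sub>R 2) < 1 / 2"
    by (intro power2_less_imp_less[of _ "1/2"]) (simp_all only: dot_square_norm, simp_all add: power_divide)
  have "\<bar>z \<bullet> b - 1 / 2\<bar> < 1 / 2" if "b \<in> Basis" for b
    using Basis_le_norm[OF that, of "z - One /\<^sub>R 2"] * that by (simp add: inner_diff_left)
  moreover have "One \<bullet> b = 1" "0 \<bullet> b = 0" if "b \<in> Basis" for b :: 'a
    using that by simp_all
  ultimately have "0 \<bullet> b \<le> z \<bullet> b \<and> z \<bullet> b \<le> One \<bullet> b" if "b \<in> Basis" for b :: 'a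
    using that by (smt (verit) field_sum_of_halves)
  then have "z \<in> cbox 0 One"
    unfolding mem_box by blast
  with that show False by simp
qed

lemma bump_borel [measurable]: "bump \<in> borel_measurable borel"
  using bump_smooth[of 0] by (intro borel_measurable_continuous_onI) (simp only: C_k.simps(1))

lemma bump_integrable: "integrable lborel (bump :: 'a::euclidean_space \<Rightarrow> real)"
proof -
  have "integrable lborel (\<lambda>z::'a. indicator (cbox 0 One) z *\<^sub>R bump z)"
    by (rule borel_integrable_compact)
      (use bump_smooth[of 0] in \<open>auto elim: continuous_on_subset\<close>)
  also have "(\<lambda>z::'a. indicator (cbox 0 One) z *\<^sub>R bump z) = bump"
    using bump_eq_0 by (force simp: indicator_def)
  finally show ?thesis .
qed

lemma bump_integral_pos: "0 < (LINT z|lborel. bump (z::'a::euclidean_space))"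
proof -
  let ?B = "ball (One /\<^sub>R 2) (1/2) :: 'a set"
  have pos: "bump z > 0" if "z \<in> ?B" for z :: 'a
  proof -
    have "norm (z - One /\<^sub>R 2) < 1 / 2"
      using that by (simp add: dist_norm norm_minus_commute)
    then have "(norm (z - One /\<^sub>R 2))\<^sup>2 < (1 / 2)\<^sup>2"
      by (intro power_strict_mono) auto
    then show ?thesis by (simp only: bump_def flat_def dot_square_norm) (simp add: power_divide)
  qed
  have "(LINT z|lborel. bump (z::'a)) \<noteq> 0"
  proof
    assume "(LINT z|lborel. bump (z::'a)) = 0"
    then have "AE z::'a in lborel. bump z = 0"
      by (subst (asm) integral_nonneg_eq_0_iff_AE) (auto simp: bump_integrable bump_nonneg)
    then have "AE z::'a in lborel. z \<notin> ?B"
      by eventually_elim (use pos in force)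
    then have "?B \<in> null_sets lborel"
      by (subst (asm) AE_iff_null_sets[symmetric]) auto
    then have "negligible ?B"
      by (simp add: negligible_iff_null_sets null_sets_completionI)
    then show False
      using open_not_negligible[of ?B] by simp
  qed
  moreover have "0 \<le> (LINT z|lborel. bump (z::'a))"
    by (simp add: bump_nonneg)
  ultimately show ?thesis by simp
qed

section \<open>Smooth averages over moving cubes\<close>

text \<open>
  The bump transported to the cube with lower corner \<open>p\<close> and side \<open>r\<close>, normalised to integral 1.
\<close>

definition mollifier :: "'a::euclidean_space \<Rightarrow> real \<Rightarrow> 'a \<Rightarrow> real" where
  "mollifier p r y = bump ((1 / r) *\<^sub>R (y - p)) / (r ^ DIM('a) * (LINT z|lborel. bump (z::'a)))"

lemma mollifier_nonneg: "0 < r \<Longrightarrow> 0 \<le> mollifier p r y"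
  using bump_integral_pos by (simp add: mollifier_def bump_nonneg less_imp_le)

lemma rescale_in_cbox_iff:
  fixes p y :: "'a::euclidean_space"
  assumes "0 < r"
  shows "(1 / r) *\<^sub>R (y - p) \<in> cbox 0 One \<longleftrightarrow> y \<in> cbox p (p + r *\<^sub>R One)"
  using assms by (auto simp: mem_box inner_simps field_simps)

lemma mollifier_eq_0: "0 < r \<Longrightarrow> y \<notin> cbox p (p + r *\<^sub>R One) \<Longrightarrow> mollifier p r y = 0"
  by (simp add: mollifier_def bump_eq_0 rescale_in_cbox_iff)

lemma bump_bounded: "\<exists>B>0. \<forall>z::'a::euclidean_space. bump z \<le> B"
proof -
  have "bounded (bump ` (cbox 0 One :: 'a set))"
    by (intro compact_imp_bounded compact_continuous_image)
      (use bump_smooth[of 0] in \<open>auto elim: continuous_on_subset\<close>)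
  then obtain B where B: "B > 0" "\<And>z::'a. z \<in> cbox 0 One \<Longrightarrow> norm (bump z) \<le> B"
    by (auto simp: bounded_pos)
  have "bump z \<le> B" for z :: 'a
    using B(1) B(2)[of z] bump_eq_0[of z] by (cases "z \<in> cbox 0 One") auto
  with B(1) show ?thesis by blast
qed

lemma mollifier_le: "\<exists>B>0. \<forall>p r (y::'a::euclidean_space). 0 < r \<longrightarrow> mollifier p r y \<le> B / r ^ DIM('a)"
proof -
  obtain B where B: "B > 0" "\<And>z::'a. bump z \<le> B"
    using bump_bounded by blast
  let ?I = "LINT z|lborel. bump (z::'a)"
  have "mollifier p r y \<le> (B / ?I) / r ^ DIM('a)" if "0 < r" for p r and y :: 'a
    using that B bump_integral_pos[where 'a='a]
    by (simp add: mollifier_def divide_simps mult.commute)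
  with B bump_integral_pos[where 'a='a] show ?thesis
    by (intro exI[of _ "B / ?I"]) auto
qed

lemma C_k_mollifier: "C_k k (mollifier p r)"
proof -
  have "C_k k (\<lambda>y. bump ((1 / r) *\<^sub>R (y - p)) * inverse (r ^ DIM('a) * (LINT z|lborel. bump (z::'a))))"
    by (intro C_k_mult C_k_const C_k_rescale bump_smooth)
  then show ?thesis by (simp add: mollifier_def[abs_def] divide_inverse)
qed

lemma mollifier_borel [measurable]: "mollifier p r \<in> borel_measurable borel"
  using C_k_mollifier[of 0 p r] by (intro borel_measurable_continuous_onI) (simp only: C_k.simps(1))

lemma mollifier_integral:
  fixes p :: "'a::euclidean_space"
  assumes "0 < r"
  shows "has_bochner_integral lborel (mollifier p r) 1"
proof -
  let ?I = "LINT z|lborel. bump (z::'a)"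
  have "integrable lborel (bump :: 'a \<Rightarrow> real)" by (rule bump_integrable)
  have eq: "lborel = density (distr lborel borel (\<lambda>x::'a. p + r *\<^sub>R x)) (\<lambda>_. ennreal (r ^ DIM('a)))"
    using lborel_affine[of r p] assms by simp
  have "has_bochner_integral lborel (\<lambda>z::'a. r ^ DIM('a) *\<^sub>R mollifier p r (p + r *\<^sub>R z)) 1"
    using bump_integrable[where 'a='a] bump_integral_pos[where 'a='a] assms
    by (auto simp: mollifier_def has_bochner_integral_iff)
  then have "has_bochner_integral (distr lborel borel (\<lambda>x::'a. p + r *\<^sub>R x))
      (\<lambda>y. r ^ DIM('a) *\<^sub>R mollifier p r y) 1"
    by (subst has_bochner_integral_distr) auto
  then show ?thesis
    by (subst eq, subst has_bochner_integral_density) (use assms in auto)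
qed

text \<open>
  If the corner \<open>p\<close> moves with velocity \<open>v\<close> and the side \<open>r\<close> grows at rate \<open>c\<close>, then this is the
  velocity of the point of the cube that is at \<open>y\<close>, when the cube is translated and dilated affinely.
\<close>

abbreviation velocity :: "'a::euclidean_space \<Rightarrow> real \<Rightarrow> 'a \<Rightarrow> real \<Rightarrow> 'a \<Rightarrow> 'a" where
  "velocity v c p r y \<equiv> v + (c / r) *\<^sub>R (y - p)"

lemma C_k_velocity: "C_k k (\<lambda>y. velocity v c p r y \<bullet> b)"
proof -
  have "C_k k (\<lambda>y. y \<bullet> ((c / r) *\<^sub>R b) + (v \<bullet> b - (c / r) * (p \<bullet> b)))"
    by (intro C_k_add C_k_inner C_k_const)
  then show ?thesis by (simp add: inner_simps algebra_simps)
qed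

text \<open>
  The components of the momentum field \<open>mollifier * velocity\<close> are the functions against which the
  weak gradient is tested.
\<close>

lemma test_function_mollifier_velocity:
  fixes p :: "'a::euclidean_space"
  assumes "0 < r" "cbox p (p + r *\<^sub>R One) \<subseteq> \<Omega>"
  shows "test_function \<Omega> (\<lambda>y. mollifier p r y * (velocity v c p r y \<bullet> b))"
proof -
  let ?S = "{y. mollifier p r y * (velocity v c p r y \<bullet> b) \<noteq> 0}"
  have "?S \<subseteq> cbox p (p + r *\<^sub>R One)"
    using mollifier_eq_0[OF assms(1)] by fastforce
  then have "closure ?S \<subseteq> cbox p (p + r *\<^sub>R One)" "bounded ?S"
    by (rule closure_minimal[OF _ closed_cbox], rule bounded_subset[OF bounded_cbox])
  with assms show ?thesis
    unfolding test_function_def compact_closure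
    using C_k_mult[OF C_k_mollifier C_k_velocity] by fast
qed

lemma mollifier_partial_deriv:
  fixes p :: "'a::euclidean_space"
  assumes "0 < r"
  shows "partial_deriv b (mollifier p r) y =
    (1 / r) * partial_deriv b bump ((1 / r) *\<^sub>R (y - p)) / (r ^ DIM('a) * (LINT z|lborel. bump (z::'a)))"
proof -
  have d: "bump differentiable (at x)" for x :: 'a
    using bump_smooth[of 1] by auto
  let ?f = "\<lambda>y. bump ((1 / r) *\<^sub>R (y - p))"
  let ?J = "r ^ DIM('a) * (LINT z|lborel. bump (z::'a))"
  have f: "(?f has_derivative frechet_derivative ?f (at y)) (at y)"
    using partial_deriv_rescale(1)[OF d] by (simp add: frechet_derivative_works[symmetric])
  have "(mollifier p r has_derivative (\<lambda>h. frechet_derivative ?f (at y) h * inverse ?J)) (at y)"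
    unfolding mollifier_def[abs_def] divide_inverse[of _ ?J] by (rule has_derivative_mult_left[OF f])
  from frechet_derivative_eq[OF this] assms show ?thesis
    by (simp only: partial_deriv_rescale(2)[OF d] divide_inverse)
qed

lemma partial_deriv_mollifier_velocity:
  fixes p :: "'a::euclidean_space"
  assumes "b \<in> Basis"
  shows "partial_deriv b (\<lambda>y. mollifier p r y * (velocity v c p r y \<bullet> b)) y =
    mollifier p r y * (c / r) + partial_deriv b (mollifier p r) y * (velocity v c p r y \<bullet> b)"
proof -
  have k: "(mollifier p r has_derivative frechet_derivative (mollifier p r) (at y)) (at y)"
    using C_k_mollifier[of 1 p r] by (simp add: frechet_derivative_works[symmetric])
  have "((\<lambda>y. (v + a *\<^sub>R (y - p)) \<bullet> b) has_derivative (\<lambda>h. a * (h \<bullet> b))) (at y)" for a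
    by (auto intro!: derivative_eq_intros)
  then have w: "((\<lambda>y. velocity v c p r y \<bullet> b) has_derivative (\<lambda>h. (c / r) * (h \<bullet> b))) (at y)" .
  show ?thesis
    using frechet_derivative_eq[OF has_derivative_mult[OF k w]] assms by simp
qed

text \<open>
  The continuity equation. The mollifier is a probability density carried along by the affine motion
  of the cube, so its time derivative is minus the divergence of density times velocity. In the computation,
  the dilation of the cube contributes \<open>DIM('a) * c / r\<close> times the density, which is the divergence of the velocity.
\<close>

lemma mollifier_transport:
  fixes p :: "'a::euclidean_space"
  assumes "0 < r + t * c"
  shows "((\<lambda>t. mollifier (p + t *\<^sub>R v) (r + t * c) y) has_real_derivative
     - (\<Sum>b\<in>Basis. partial_deriv b
         (\<lambda>y. mollifier (p + t *\<^sub>R v) (r + t * c) y * (velocity v c (p + t *\<^sub>R v) (r + t * c) y \<bullet> b)) y)) (at t)"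
proof -
  define I where "I = (LINT z|lborel. bump (z::'a))"
  have I: "I > 0" using bump_integral_pos by (simp add: I_def)
  define q where "q = p + t *\<^sub>R v"
  define s where "s = r + t * c"
  define V where "V = velocity v c q s y"
  define z where "z = (1 / s) *\<^sub>R (y - q)"
  have s: "s > 0" using assms by (simp add: s_def)
  let ?D = "frechet_derivative bump (at z)"
  have bump: "(bump has_derivative ?D) (at z)"
    using bump_smooth[of 1, where 'a='a] by (simp add: frechet_derivative_works[symmetric])
  then have lin: "linear ?D" by (rule has_derivative_linear)
  have Z: "((\<lambda>t. (1 / (r + t * c)) *\<^sub>R (y - (p + t *\<^sub>R v))) has_derivative (\<lambda>h. h *\<^sub>R (- (1 / s)) *\<^sub>R V)) (at t)"
  proof -
    have "((\<lambda>t. 1 / (r + t * c)) has_real_derivative - (c / (s * s))) (at t)"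
      using s unfolding s_def by (auto intro!: derivative_eq_intros)
    moreover have "((\<lambda>t. y - (p + t *\<^sub>R v)) has_vector_derivative - v) (at t)"
      by (auto intro!: derivative_eq_intros)
    ultimately have "((\<lambda>t. (1 / (r + t * c)) *\<^sub>R (y - (p + t *\<^sub>R v))) has_vector_derivative
        (1 / (r + t * c)) *\<^sub>R (- v) + (- (c / (s * s))) *\<^sub>R (y - (p + t *\<^sub>R v))) (at t)"
      by (rule has_vector_derivative_scaleR)
    also have "(1 / (r + t * c)) *\<^sub>R (- v) + (- (c / (s * s))) *\<^sub>R (y - (p + t *\<^sub>R v)) = (- (1 / s)) *\<^sub>R V"
      by (simp add: V_def q_def[symmetric] s_def[symmetric] scaleR_right_distrib)
    finally show ?thesis by (simp only: has_vector_derivative_def)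
  qed
  have "((\<lambda>t. bump ((1 / (r + t * c)) *\<^sub>R (y - (p + t *\<^sub>R v)))) has_derivative
      (\<lambda>h. ?D (h *\<^sub>R (- (1 / s)) *\<^sub>R V))) (at t)"
    by (rule has_derivative_compose[OF Z]) (use bump in \<open>simp add: z_def s_def q_def\<close>)
  also have "(\<lambda>h. ?D (h *\<^sub>R (- (1 / s)) *\<^sub>R V)) = (*) (- ?D V / s)"
    by (auto simp: linear_scale[OF lin] linear_neg[OF lin])
  finally have B: "((\<lambda>t. bump ((1 / (r + t * c)) *\<^sub>R (y - (p + t *\<^sub>R v)))) has_real_derivative - ?D V / s) (at t)"
    by (simp only: has_field_derivative_def)
  have P: "((\<lambda>t. (r + t * c) ^ DIM('a) * I) has_real_derivative DIM('a) * s ^ (DIM('a) - 1) * c * I) (at t)"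
    by (auto intro!: derivative_eq_intros simp: s_def)
  have "((\<lambda>t. mollifier (p + t *\<^sub>R v) (r + t * c) y) has_real_derivative
     ((- ?D V / s) * (s ^ DIM('a) * I) - bump z * (DIM('a) * s ^ (DIM('a) - 1) * c * I)) /
     ((s ^ DIM('a) * I) * (s ^ DIM('a) * I))) (at t)"
    unfolding mollifier_def[abs_def] I_def[symmetric]
    using DERIV_divide[OF B P] s I by (simp add: s_def z_def q_def)
  also have "((- ?D V / s) * (s ^ DIM('a) * I) - bump z * (DIM('a) * s ^ (DIM('a) - 1) * c * I)) /
     ((s ^ DIM('a) * I) * (s ^ DIM('a) * I)) = - (DIM('a) * (mollifier q s y * (c / s)) + ?D V / s / (s ^ DIM('a) * I))"
  proof -
    have "s ^ DIM('a) = s * s ^ (DIM('a) - 1)"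
      by (metis DIM_positive power_eq_if less_not_refl)
    with s I show ?thesis
      by (simp add: mollifier_def I_def[symmetric] z_def[symmetric] field_simps)
  qed
  also have "DIM('a) * (mollifier q s y * (c / s)) + ?D V / s / (s ^ DIM('a) * I) =
     (\<Sum>b\<in>Basis. mollifier q s y * (c / s) + partial_deriv b (mollifier q s) y * (V \<bullet> b))"
  proof -
    have "?D V = ?D (\<Sum>b\<in>Basis. (V \<bullet> b) *\<^sub>R b)" by (simp add: euclidean_representation)
    also have "\<dots> = (\<Sum>b\<in>Basis. (V \<bullet> b) * ?D b)"
      by (simp add: linear_sum[OF lin] linear_scale[OF lin])
    finally have "?D V / s / (s ^ DIM('a) * I) = (\<Sum>b\<in>Basis. partial_deriv b (mollifier q s) y * (V \<bullet> b))"
      by (simp add: mollifier_partial_deriv[OF s] z_def[symmetric] I_def[symmetric] sum_divide_distrib mult_ac)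
    then show ?thesis by (simp add: sum.distrib)
  qed
  also have "\<dots> = (\<Sum>b\<in>Basis. partial_deriv b (\<lambda>y. mollifier q s y * (velocity v c q s y \<bullet> b)) y)"
    by (intro sum.cong refl) (simp add: partial_deriv_mollifier_velocity V_def)
  finally show ?thesis by (simp only: q_def s_def)
qed

lemma bump_gradient_bounded:
  "\<exists>B\<ge>0. \<forall>z::'a::euclidean_space. \<forall>b\<in>Basis. \<bar>partial_deriv b bump z\<bar> \<le> B"
  and bump_gradient_eq_0: "w \<notin> cbox 0 One \<Longrightarrow> frechet_derivative bump (at (w::'a)) h = 0"
proof -
  have zero: "frechet_derivative bump (at w) h = 0" if "w \<notin> cbox 0 One" for w h :: 'a
  proof -
    have "((\<lambda>_. 0) has_derivative (\<lambda>_. 0)) (at w)" by simp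
    then have "(bump has_derivative (\<lambda>_. 0)) (at w)"
      by (rule has_derivative_transform_within_open[where s="- cbox 0 One"])
        (use that bump_eq_0 in auto)
    then show ?thesis by (simp add: frechet_derivative_eq)
  qed
  then show "w \<notin> cbox 0 One \<Longrightarrow> frechet_derivative bump (at (w::'a)) h = 0" .
  have "\<exists>B\<ge>0. \<forall>z. \<bar>partial_deriv b bump z\<bar> \<le> B" if "b \<in> Basis" for b :: 'a
  proof -
    have "continuous_on UNIV (partial_deriv b (bump :: 'a \<Rightarrow> real))"
      using bump_smooth[of 1] that by auto
    then have "bounded (partial_deriv b bump ` (cbox 0 One :: 'a set))"
      by (intro compact_imp_bounded compact_continuous_image) (auto elim: continuous_on_subset)
    then obtain B where B: "B > 0" "\<And>z::'a. z \<in> cbox 0 One \<Longrightarrow> \<bar>partial_deriv b bump z\<bar> \<le> B"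
      by (auto simp: bounded_pos)
    have "\<bar>partial_deriv b bump z\<bar> \<le> B" for z :: 'a
      using B(1) B(2)[of z] zero[of z b] by (cases "z \<in> cbox 0 One") auto
    with B(1) show ?thesis by (intro exI[of _ B]) auto
  qed
  then obtain B where B: "\<And>b::'a. b \<in> Basis \<Longrightarrow> 0 \<le> B b \<and> (\<forall>z. \<bar>partial_deriv b bump z\<bar> \<le> B b)"
    by metis
  have "\<bar>partial_deriv b bump z\<bar> \<le> sum B Basis" if "b \<in> Basis" for b z :: 'a
  proof -
    have "B b \<le> sum B Basis" using B that by (intro member_le_sum) auto
    with B[OF that] show ?thesis using order_trans by blast
  qed
  moreover have "0 \<le> sum B Basis" using B by (auto intro: sum_nonneg)
  ultimately show "\<exists>B\<ge>0. \<forall>z::'a. \<forall>b\<in>Basis. \<bar>partial_deriv b bump z\<bar> \<le> B"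
    by blast
qed

lemma norm_diff_le_of_mem_cbox:
  fixes p :: "'a::euclidean_space" and r :: real
  assumes "y \<in> cbox p (p + r *\<^sub>R One)"
  shows "norm (y - p) \<le> DIM('a) * r"
proof -
  have "norm (y - p) \<le> (\<Sum>b\<in>Basis. \<bar>(y - p) \<bullet> b\<bar>)" by (rule norm_le_l1)
  also have "\<dots> \<le> (\<Sum>b\<in>(Basis::'a set). r)"
    by (rule sum_mono) (use assms in \<open>force simp: mem_box inner_simps\<close>)
  finally show ?thesis by simp
qed

lemma norm_velocity_le:
  fixes p :: "'a::euclidean_space" and c :: real
  assumes "0 < r" "y \<in> cbox p (p + r *\<^sub>R One)"
  shows "norm (velocity v c p r y) \<le> norm v + DIM('a) * \<bar>c\<bar>"
proof -
  have "\<bar>c\<bar> / r * norm (y - p) \<le> \<bar>c\<bar> / r * (DIM('a) * r)"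
    using assms(1) norm_diff_le_of_mem_cbox[OF assms(2)] by (intro mult_left_mono) auto
  then have "norm ((c / r) *\<^sub>R (y - p)) \<le> \<bar>c\<bar> / r * (DIM('a) * r)"
    using assms(1) by (simp add: abs_divide)
  also have "\<dots> = DIM('a) * \<bar>c\<bar>" using assms(1) by simp
  finally show ?thesis using norm_triangle_le[of v "(c / r) *\<^sub>R (y - p)"] by force
qed

text \<open>
  A bound that is uniform in the position of the cube, and in its side as long as this stays
  away from 0; it dominates the difference quotients when differentiating averages of an integrable function.
\<close>

lemma partial_deriv_mollifier_velocity_bounded:
  fixes v :: "'a::euclidean_space" and c :: real
  assumes "0 < \<rho>"
  shows "\<exists>L. \<forall>p r y. \<forall>b\<in>Basis. \<rho> \<le> r \<longrightarrow>
    \<bar>partial_deriv b (\<lambda>y. mollifier p r y * (velocity v c p r y \<bullet> b)) y\<bar> \<le> L"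
proof -
  obtain B where B: "B > 0" "\<And>p r (y::'a). 0 < r \<Longrightarrow> mollifier p r y \<le> B / r ^ DIM('a)"
    using mollifier_le by blast
  obtain B' where B': "B' \<ge> 0" "\<And>z b::'a. b \<in> Basis \<Longrightarrow> \<bar>partial_deriv b bump z\<bar> \<le> B'"
    using bump_gradient_bounded by blast
  define I where "I = (LINT z|lborel. bump (z::'a))"
  have I: "I > 0" using bump_integral_pos by (simp add: I_def)
  define L where "L = B / \<rho> ^ DIM('a) * (\<bar>c\<bar> / \<rho>) + 1 / \<rho> * B' / (\<rho> ^ DIM('a) * I) * (norm v + DIM('a) * \<bar>c\<bar>)"
  have L: "\<bar>partial_deriv b (\<lambda>y. mollifier p r y * (velocity v c p r y \<bullet> b)) y\<bar> \<le> L"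
    if r: "\<rho> \<le> r" and b: "b \<in> Basis" for p r b and y :: 'a
  proof -
    have r0: "0 < r" and pow: "\<rho> ^ DIM('a) \<le> r ^ DIM('a)" using r assms by (auto intro: power_mono)
    have "\<bar>mollifier p r y * (c / r)\<bar> = mollifier p r y * (\<bar>c\<bar> / r)"
      using mollifier_nonneg[OF r0, of p y] r0 by (simp add: abs_mult)
    also have "\<dots> \<le> B / \<rho> ^ DIM('a) * (\<bar>c\<bar> / \<rho>)"
    proof (rule mult_mono)
      show "mollifier p r y \<le> B / \<rho> ^ DIM('a)"
        using B(2)[OF r0, of p y] frac_le[of B B "\<rho> ^ DIM('a)" "r ^ DIM('a)"] B(1) pow assms by fastforce
    qed (use r0 r assms B mollifier_nonneg[OF r0, of p y] in \<open>auto intro: frac_le\<close>)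
    finally have 1: "\<bar>mollifier p r y * (c / r)\<bar> \<le> B / \<rho> ^ DIM('a) * (\<bar>c\<bar> / \<rho>)" .
    have 2: "\<bar>partial_deriv b (mollifier p r) y * (velocity v c p r y \<bullet> b)\<bar> \<le>
        1 / \<rho> * B' / (\<rho> ^ DIM('a) * I) * (norm v + DIM('a) * \<bar>c\<bar>)"
    proof (cases "y \<in> cbox p (p + r *\<^sub>R One)")
      case True
      have "\<bar>partial_deriv b (mollifier p r) y\<bar> \<le> 1 / \<rho> * B' / (\<rho> ^ DIM('a) * I)"
        unfolding mollifier_partial_deriv[OF r0] I_def[symmetric] abs_divide abs_mult
        using r0 r assms B' b I pow by (intro frac_le mult_mono) auto
      moreover have "\<bar>velocity v c p r y \<bullet> b\<bar> \<le> norm v + DIM('a) * \<bar>c\<bar>"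
        using norm_velocity_le[OF r0 True, of v c] Basis_le_norm[OF b] order_trans by blast
      ultimately show ?thesis
        unfolding abs_mult by (intro mult_mono) auto
    next
      case False
      then show ?thesis
        using r0 assms B' I by (simp add: mollifier_partial_deriv bump_gradient_eq_0 rescale_in_cbox_iff)
    qed
    from 1 2 show ?thesis unfolding partial_deriv_mollifier_velocity[OF b] L_def by linarith
  qed
  then show ?thesis by blast
qed

text \<open>
  Differentiation under the integral sign for a merely integrable factor \<open>v\<close>: by the mean value
  inequality the difference quotients of \<open>k\<close> are bounded by \<open>L\<close>, so dominated convergence applies.
\<close>

lemma has_derivative_integral_mult:
  fixes k k' :: "real \<Rightarrow> 'a \<Rightarrow> real"
  assumes v: "integrable M v" and U: "convex U" "t0 \<in> U"
    and [measurable]: "\<And>t. t \<in> U \<Longrightarrow> k t \<in> borel_measurable M" "k' t0 \<in> borel_measurable M"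
    and int: "\<And>t. t \<in> U \<Longrightarrow> integrable M (\<lambda>y. v y * k t y)"
    and der: "\<And>t y. t \<in> U \<Longrightarrow> ((\<lambda>t. k t y) has_real_derivative k' t y) (at t within U)"
    and bound: "\<And>t y. t \<in> U \<Longrightarrow> \<bar>k' t y\<bar> \<le> L"
  shows "((\<lambda>t. LINT y|M. v y * k t y) has_real_derivative (LINT y|M. v y * k' t0 y)) (at t0 within U)"
  unfolding has_field_derivative_iff tendsto_at_iff_sequentially
proof (intro allI impI)
  fix X :: "nat \<Rightarrow> real" assume X: "\<forall>i. X i \<in> U - {t0}" "X \<longlonglongrightarrow> t0"
  have [measurable]: "v \<in> borel_measurable M" using v by simp
  have [measurable]: "k (X i) \<in> borel_measurable M" "k t0 \<in> borel_measurable M" for i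
    using X U by auto
  have "(\<lambda>i. LINT y|M. v y * ((k (X i) y - k t0 y) / (X i - t0))) \<longlonglongrightarrow> (LINT y|M. v y * k' t0 y)"
  proof (rule integral_dominated_convergence[where w="\<lambda>y. \<bar>L\<bar> * \<bar>v y\<bar>"])
    show "AE y in M. (\<lambda>i. v y * ((k (X i) y - k t0 y) / (X i - t0))) \<longlonglongrightarrow> v y * k' t0 y"
    proof (intro AE_I2 tendsto_mult_left)
      fix y
      have "((\<lambda>t. (k t y - k t0 y) / (t - t0)) \<longlongrightarrow> k' t0 y) (at t0 within U)"
        using der[OF U(2)] by (simp add: has_field_derivative_iff)
      then show "(\<lambda>i. (k (X i) y - k t0 y) / (X i - t0)) \<longlonglongrightarrow> k' t0 y"
        using X unfolding tendsto_at_iff_sequentially by (auto simp: o_def)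
    qed
    show "AE y in M. norm (v y * ((k (X i) y - k t0 y) / (X i - t0))) \<le> \<bar>L\<bar> * \<bar>v y\<bar>" for i
    proof (intro AE_I2)
      fix y
      have "norm (k (X i) y - k t0 y) \<le> \<bar>L\<bar> * norm (X i - t0)"
        by (rule field_differentiable_bound[OF U(1) der])
          (use X U bound in \<open>auto intro: order_trans[OF bound]\<close>)
      then have "\<bar>(k (X i) y - k t0 y) / (X i - t0)\<bar> \<le> \<bar>L\<bar>"
        using X by (auto simp: abs_divide divide_le_eq)
      then show "norm (v y * ((k (X i) y - k t0 y) / (X i - t0))) \<le> \<bar>L\<bar> * \<bar>v y\<bar>"
        by (simp only: real_norm_def abs_mult) (metis abs_ge_zero mult.commute mult_right_mono)
    qed
    show "integrable M (\<lambda>y. \<bar>L\<bar> * \<bar>v y\<bar>)" using v by simp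
  qed measurable
  moreover have "(LINT y|M. v y * ((k (X i) y - k t0 y) / (X i - t0))) =
      ((LINT y|M. v y * k (X i) y) - (LINT y|M. v y * k t0 y)) / (X i - t0)" for i
  proof -
    have "(\<lambda>y. v y * ((k (X i) y - k t0 y) / (X i - t0))) = (\<lambda>y. (v y * k (X i) y - v y * k t0 y) / (X i - t0))"
      by (auto simp: algebra_simps diff_divide_distrib)
    moreover have "integrable M (\<lambda>y. v y * k (X i) y)" "integrable M (\<lambda>y. v y * k t0 y)"
      using int X U by auto
    ultimately show ?thesis by simp
  qed
  ultimately show "((\<lambda>t. ((LINT y|M. v y * k t y) - (LINT y|M. v y * k t0 y)) / (t - t0)) \<circ> X)
      \<longlonglongrightarrow> (LINT y|M. v y * k' t0 y)"
    by (simp only: o_def)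
qed

definition mollify :: "('a::euclidean_space \<Rightarrow> real) \<Rightarrow> 'a \<Rightarrow> real \<Rightarrow> real" where
  "mollify v p r = (LINT y|lborel. v y * mollifier p r y)"

text \<open>
  The weak gradient relation for functions on the whole space, with both sides integrated over all
  of space. It is applied to Borel functions that vanish outside \<open>\<Omega>\<close>, which makes product measures and convolutions
  with respect to \<^const>\<open>lborel\<close> available.
\<close>

definition integrable_weak_gradient :: "'a::euclidean_space set \<Rightarrow> ('a \<Rightarrow> real) \<Rightarrow> ('a \<Rightarrow> 'a) \<Rightarrow> bool" where
  "integrable_weak_gradient \<Omega> v G \<longleftrightarrow> integrable lborel v \<and> integrable lborel G \<and>
     (\<forall>\<phi>. \<forall>b\<in>Basis. test_function \<Omega> \<phi> \<longrightarrow>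
        (LINT y|lborel. v y * partial_deriv b \<phi> y) = - (LINT y|lborel. (G y \<bullet> b) * \<phi> y))"

lemma integrable_mult_bounded:
  fixes v k :: "'a \<Rightarrow> real"
  assumes "integrable M v" "k \<in> borel_measurable M" "\<And>y. \<bar>k y\<bar> \<le> L"
  shows "integrable M (\<lambda>y. v y * k y)"
proof (rule Bochner_Integration.integrable_bound)
  show "integrable M (\<lambda>y. L * v y)" using assms by simp
  show "AE y in M. norm (v y * k y) \<le> norm (L * v y)"
  proof (intro AE_I2)
    fix y
    have "\<bar>v y\<bar> * \<bar>k y\<bar> \<le> \<bar>v y\<bar> * \<bar>L\<bar>"
      by (intro mult_left_mono) (use assms(3)[of y] in auto)
    then show "norm (v y * k y) \<le> norm (L * v y)" by (simp add: abs_mult mult.commute)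
  qed
qed (use assms in auto)

text \<open>
  How much an average changes when the cube is moved along a segment inside \<open>\<Omega>\<close>. By the continuity
  equation and the definition of the weak gradient, the derivative of the average is the integral of
  \<open>mollifier * (velocity \<bullet> G)\<close>; the mollifier is at most \<open>B / \<rho> ^ DIM('a)\<close>, and the velocity is controlled
  on the cube.
\<close>

lemma mollify_segment_bound:
  fixes p q :: "'a::euclidean_space" and r r' \<rho> B :: real
  assumes wg: "integrable_weak_gradient \<Omega> v G"
    and B: "0 < B" "\<And>p r (y::'a). 0 < r \<Longrightarrow> mollifier p r y \<le> B / r ^ DIM('a)"
    and \<rho>: "0 < \<rho>" "\<rho> \<le> r" "\<rho> \<le> r'"
    and E: "E \<in> sets borel"
    and sub: "\<And>t. t \<in> {0..1} \<Longrightarrow>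
      cbox (p + t *\<^sub>R (q - p)) (p + t *\<^sub>R (q - p) + (r + t * (r' - r)) *\<^sub>R One) \<subseteq> \<Omega> \<inter> E"
  shows "\<bar>mollify v q r' - mollify v p r\<bar> \<le>
       (norm (q - p) + DIM('a) * \<bar>r' - r\<bar>) * (B / \<rho> ^ DIM('a)) * (LINT y|lborel. indicator E y * norm (G y))"
proof -
  note [measurable] = E
  define w where "w = q - p"
  define c where "c = r' - r"
  define P where "P t = p + t *\<^sub>R w" for t
  define S where "S t = r + t * c" for t
  define V where "V t y = velocity w c (P t) (S t) y" for t y
  define \<psi> where "\<psi> b t y = mollifier (P t) (S t) y * (V t y \<bullet> b)" for b t y
  define k' where "k' t y = - (\<Sum>b\<in>Basis. partial_deriv b (\<psi> b t) y)" for t y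
  define K where "K = (norm w + DIM('a) * \<bar>c\<bar>) * (B / \<rho> ^ DIM('a))"
  define N where "N = (LINT y|lborel. indicator E y * norm (G y))"
  have v: "integrable lborel v" and G: "integrable lborel G"
    and weak: "\<And>\<phi> b. b \<in> Basis \<Longrightarrow> test_function \<Omega> \<phi> \<Longrightarrow>
      (LINT y|lborel. v y * partial_deriv b \<phi> y) = - (LINT y|lborel. (G y \<bullet> b) * \<phi> y)"
    using wg by (auto simp: integrable_weak_gradient_def)
  have [measurable]: "v \<in> borel_measurable borel" "G \<in> borel_measurable borel"
    using v G by auto
  have K0: "0 \<le> K" using B \<rho> by (auto simp: K_def)
  have S: "\<rho> \<le> S t" if "t \<in> {0..1}" for t
  proof -
    have "(1 - t) * \<rho> + t * \<rho> \<le> (1 - t) * r + t * r'"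
      using that \<rho> by (intro add_mono mult_left_mono) auto
    then show ?thesis by (simp add: S_def c_def algebra_simps)
  qed
  then have S0: "0 < S t" if "t \<in> {0..1}" for t using \<rho>(1) that by fastforce
  have box: "cbox (P t) (P t + S t *\<^sub>R One) \<subseteq> \<Omega>" "cbox (P t) (P t + S t *\<^sub>R One) \<subseteq> E"
    if "t \<in> {0..1}" for t
    using sub that by (auto simp: P_def S_def w_def c_def)
  have m_le: "mollifier (P t) (S t) y \<le> B / \<rho> ^ DIM('a)" if "t \<in> {0..1}" for t y
  proof -
    have "B / S t ^ DIM('a) \<le> B / \<rho> ^ DIM('a)"
      using B(1) \<rho>(1) S[OF that] by (intro divide_left_mono power_mono mult_pos_pos zero_less_power) auto
    with B(2)[OF S0[OF that]] show ?thesis using order_trans by blast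
  qed
  have \<psi>_test: "test_function \<Omega> (\<psi> b t)" if "t \<in> {0..1}" for b t
    using test_function_mollifier_velocity[OF S0[OF that] box(1)[OF that], of w c b]
    by (simp add: \<psi>_def[abs_def] V_def)
  have \<psi>_C: "continuous_on UNIV (\<psi> b t)" "\<forall>b\<in>Basis. continuous_on UNIV (partial_deriv b (\<psi> b' t))"
    if "t \<in> {0..1}" for b b' t
    using \<psi>_test[OF that, of b] \<psi>_test[OF that, of b'] unfolding test_function_def
    by (metis C_k.simps(1), metis C_k.simps(1,2))
  then have \<psi>_borel: "\<psi> b t \<in> borel_measurable borel" "b' \<in> Basis \<Longrightarrow> partial_deriv b' (\<psi> b t) \<in> borel_measurable borel"
    if "t \<in> {0..1}" for b b' t
    using that by (auto intro: borel_measurable_continuous_onI)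
  obtain L where L: "\<And>b t y. b \<in> Basis \<Longrightarrow> t \<in> {0..1} \<Longrightarrow> \<bar>partial_deriv b (\<psi> b t) y\<bar> \<le> L"
    using partial_deriv_mollifier_velocity_bounded[OF \<rho>(1), of w c] S
    unfolding \<psi>_def[abs_def] V_def by meson
  have mV: "\<bar>(V t y \<bullet> z) * mollifier (P t) (S t) y\<bar> \<le> K * (indicator E y * norm z)"
    if t: "t \<in> {0..1}" for t y z
  proof (cases "y \<in> cbox (P t) (P t + S t *\<^sub>R One)")
    case True
    have "\<bar>V t y \<bullet> z\<bar> \<le> (norm w + DIM('a) * \<bar>c\<bar>) * norm z"
      using Cauchy_Schwarz_ineq2[of "V t y" z] norm_velocity_le[OF S0[OF t] True, of w c]
      unfolding V_def by (meson mult_right_mono norm_ge_zero order_trans)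
    then have "\<bar>V t y \<bullet> z\<bar> * mollifier (P t) (S t) y \<le> ((norm w + DIM('a) * \<bar>c\<bar>) * norm z) * (B / \<rho> ^ DIM('a))"
      using m_le[OF t] mollifier_nonneg[OF S0[OF t]] by (intro mult_mono) auto
    then show ?thesis
      using box(2)[OF t] True mollifier_nonneg[OF S0[OF t], of "P t" y]
      by (auto simp: K_def abs_mult mult_ac)
  next
    case False
    then have "mollifier (P t) (S t) y = 0" by (rule mollifier_eq_0[OF S0[OF t]])
    with K0 show ?thesis by simp
  qed
  have der: "((\<lambda>t. LINT y|lborel. v y * mollifier (P t) (S t) y) has_real_derivative
      (LINT y|lborel. v y * k' t y)) (at t within {0..1})" if t: "t \<in> {0..1}" for t
  proof (rule has_derivative_integral_mult[OF v convex_real_interval(5) t, where L="DIM('a) * L"])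
    show "k' t \<in> borel_measurable lborel"
      unfolding k'_def[abs_def] using \<psi>_borel[OF t] by simp
    show "integrable lborel (\<lambda>y. v y * mollifier (P t) (S t) y)" if "t \<in> {0..1}" for t
    proof (rule integrable_mult_bounded[OF v])
      show "\<bar>mollifier (P t) (S t) y\<bar> \<le> B / \<rho> ^ DIM('a)" for y
        using m_le[OF that, of y] mollifier_nonneg[OF S0[OF that], of "P t" y] by linarith
    qed simp
    show "((\<lambda>t. mollifier (P t) (S t) y) has_real_derivative k' t y) (at t within {0..1})" if "t \<in> {0..1}" for t y
      using mollifier_transport[of r t c p w y] S0[OF that] has_field_derivative_at_within
      unfolding P_def[abs_def] S_def[abs_def] k'_def[abs_def] \<psi>_def[abs_def] V_def by blast
    show "\<bar>k' t y\<bar> \<le> DIM('a) * L" if "t \<in> {0..1}" for t y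
    proof -
      have "(\<Sum>b\<in>Basis. \<bar>partial_deriv b (\<psi> b t) y\<bar>) \<le> (\<Sum>b\<in>(Basis::'a set). L)"
        using L that by (intro sum_mono) auto
      then show ?thesis
        unfolding k'_def abs_minus by (intro order_trans[OF sum_abs]) simp
    qed
  qed auto
  have eq: "(LINT y|lborel. v y * k' t y) = (LINT y|lborel. (V t y \<bullet> G y) * mollifier (P t) (S t) y)"
    if t: "t \<in> {0..1}" for t
  proof -
    have "(LINT y|lborel. v y * k' t y) = - (LINT y|lborel. (\<Sum>b\<in>Basis. v y * partial_deriv b (\<psi> b t) y))"
      by (simp add: k'_def sum_distrib_left)
    also have "(LINT y|lborel. (\<Sum>b\<in>Basis. v y * partial_deriv b (\<psi> b t) y)) =
        (\<Sum>b\<in>Basis. LINT y|lborel. v y * partial_deriv b (\<psi> b t) y)"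
      using L \<psi>_borel(2)[OF t] t
      by (intro Bochner_Integration.integral_sum integrable_mult_bounded[OF v, where L=L]) auto
    also have "\<dots> = (\<Sum>b\<in>Basis. - (LINT y|lborel. (G y \<bullet> b) * \<psi> b t y))"
      by (intro sum.cong refl weak \<psi>_test t)
    also have "- \<dots> = (\<Sum>b\<in>Basis. LINT y|lborel. (G y \<bullet> b) * \<psi> b t y)"
      by (simp add: sum_negf)
    also have "\<dots> = (LINT y|lborel. (\<Sum>b\<in>Basis. (G y \<bullet> b) * \<psi> b t y))"
    proof (intro Bochner_Integration.integral_sum[symmetric] integrable_mult_bounded[where L=K])
      fix b y assume b: "b \<in> (Basis :: 'a set)"
      have "\<bar>\<psi> b t y\<bar> \<le> K * (indicator E y * norm b)"
        using mV[OF t, of y b] by (simp add: \<psi>_def mult.commute)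
      also have "\<dots> \<le> K" using K0 b by (auto simp: indicator_def)
      finally show "\<bar>\<psi> b t y\<bar> \<le> K" .
    qed (use G \<psi>_borel(1)[OF t] in auto)
    also have "\<dots> = (LINT y|lborel. (V t y \<bullet> G y) * mollifier (P t) (S t) y)"
      by (intro Bochner_Integration.integral_cong refl)
        (simp add: \<psi>_def euclidean_inner[of "V t _" "G _"] sum_distrib_right sum_distrib_left mult_ac)
    finally show ?thesis .
  qed
  have bound: "norm (LINT y|lborel. v y * k' t y) \<le> K * N" if t: "t \<in> {0..1}" for t
  proof -
    have int: "integrable lborel (\<lambda>y. K * (indicator E y * norm (G y)))"
      using integrable_mult_indicator[OF _ integrable_norm[OF G], of E] E by simp
    have "norm (LINT y|lborel. (V t y \<bullet> G y) * mollifier (P t) (S t) y) \<le>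
        (LINT y|lborel. K * (indicator E y * norm (G y)))"
      using mV[OF t] K0
      by (intro order_trans[OF integral_norm_bound] Bochner_Integration.integral_mono'[OF int]) auto
    with eq[OF t] show ?thesis by (simp add: N_def)
  qed
  have "norm ((LINT y|lborel. v y * mollifier (P 1) (S 1) y) - (LINT y|lborel. v y * mollifier (P 0) (S 0) y))
      \<le> K * N * norm (1 - 0 :: real)"
    by (rule field_differentiable_bound[OF convex_real_interval(5)[of 0 1] der bound]) auto
  then show "\<bar>mollify v q r' - mollify v p r\<bar> \<le>
     (norm (q - p) + DIM('a) * \<bar>r' - r\<bar>) * (B / \<rho> ^ DIM('a)) * (LINT y|lborel. indicator E y * norm (G y))"
    by (simp add: mollify_def P_def S_def w_def c_def K_def N_def)
qed

section \<open>Oscillation of the averages over a connected family of cubes\<close>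

lemma cbox_segment_subset_ball:
  fixes p q :: "'a::euclidean_space" and r r' s R :: real
  assumes "t \<in> {0..1}" "0 < r" "0 < r'" "norm (q - p) \<le> \<delta>" "r \<le> s" "r' \<le> s" "\<delta> + DIM('a) * s < R"
  shows "cbox (p + t *\<^sub>R (q - p)) (p + t *\<^sub>R (q - p) + (r + t * (r' - r)) *\<^sub>R One) \<subseteq> ball p R"
proof
  fix y assume y: "y \<in> cbox (p + t *\<^sub>R (q - p)) (p + t *\<^sub>R (q - p) + (r + t * (r' - r)) *\<^sub>R One)"
  have "r + t * (r' - r) = (1 - t) * r + t * r'" by (simp add: algebra_simps)
  also have "\<dots> \<le> (1 - t) * s + t * s"
    using assms by (intro add_mono mult_left_mono) auto
  finally have "DIM('a) * (r + t * (r' - r)) \<le> DIM('a) * s"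
    by (intro mult_left_mono) (auto simp: algebra_simps)
  moreover have "norm (y - (p + t *\<^sub>R (q - p))) \<le> DIM('a) * (r + t * (r' - r))"
    by (rule norm_diff_le_of_mem_cbox[OF y])
  moreover have "norm (t *\<^sub>R (q - p)) \<le> \<delta>"
    using assms mult_left_le_one_le[of "norm (q - p)" t] by auto
  moreover have "norm (y - p) \<le> norm (y - (p + t *\<^sub>R (q - p))) + norm (t *\<^sub>R (q - p))"
    using norm_triangle_ineq[of "y - (p + t *\<^sub>R (q - p))" "t *\<^sub>R (q - p)"] by simp
  ultimately have "norm (y - p) < R"
    using assms(7) by linarith
  then show "y \<in> ball p R" by (simp add: dist_norm norm_minus_commute)
qed

text \<open>
  All cubes of side comparable to \<open>s\<close> and at distance at most \<open>A * s\<close> from \<open>x\<close>: after rescaling by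
  \<open>s\<close> their corners lie in a fixed compact ball, which is covered by finitely many balls of radius \<open>1 / 2\<close>. Two
  cubes with corners in the same ball can be joined by a segment, so the averages over them lie in an interval of
  length comparable to \<open>s\<close> times the mean of \<open>norm G\<close> near \<open>x\<close>. The conclusion bounds the Lebesgue measure
  of a set of reals containing all the averages, the union of one such interval for each ball.
\<close>

lemma mollify_shell_image:
  fixes A :: real
  shows "\<exists>c\<ge>0. \<forall>\<Omega> v G (x::'a::euclidean_space) (s::real). integrable_weak_gradient \<Omega> v G \<longrightarrow> 0 < s \<longrightarrow>
    (\<exists>C\<in>sets borel.
      (\<forall>p r. s / 2 < r \<longrightarrow> r \<le> s \<longrightarrow> norm (p - x) \<le> A * s \<longrightarrow> ball p (4 * real DIM('a) * r) \<subseteq> \<Omega> \<longrightarrow> mollify v p r \<in> C) \<and>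
      emeasure lborel C \<le> ennreal (c * s / s ^ DIM('a) *
         (LINT y|lborel. indicator (ball x ((A + 4 * real DIM('a)) * s)) y * norm (G y))))"
proof -
  let ?n = "real DIM('a)"
  obtain B where B: "B > 0" "\<And>p r (y::'a). 0 < r \<Longrightarrow> mollifier p r y \<le> B / r ^ DIM('a)"
    using mollifier_le by blast
  have "compact (cball (0::'a) A)" by simp
  moreover have "cball (0::'a) A \<subseteq> (\<Union>z. ball z (1 / 2))"
  proof
    fix x :: 'a show "x \<in> (\<Union>z. ball z (1 / 2))" by (rule UN_I[of x]) auto
  qed
  ultimately obtain Z where Z: "finite Z" "cball (0::'a) A \<subseteq> (\<Union>z\<in>Z. ball z (1 / 2))"
    using compactE_image[of "cball (0::'a) A" UNIV "\<lambda>z. ball z (1 / 2)"] by auto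
  define c where "c = card Z * (2 * ((1 + ?n) * (B * 2 ^ DIM('a))))"
  show ?thesis
  proof (intro exI[of _ c] conjI allI impI)
    show "0 \<le> c" using B by (simp add: c_def)
    fix \<Omega> v and G :: "'a \<Rightarrow> 'a" and x :: 'a and s :: real
    assume wg: "integrable_weak_gradient \<Omega> v G" and s: "0 < s"
    define E where "E = ball x ((A + 4 * ?n) * s)"
    define N where "N = (LINT y|lborel. indicator E y * norm (G y))"
    define \<omega> where "\<omega> = (1 + ?n) * s * (B / (s / 2) ^ DIM('a)) * N"
    define T where "T z = {(p, r). s / 2 < r \<and> r \<le> s \<and> norm (p - x) \<le> A * s \<and> ball p (4 * ?n * r) \<subseteq> \<Omega>
        \<and> norm ((1 / s) *\<^sub>R (p - x) - z) < 1 / 2}" for z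
    have N: "0 \<le> N" by (auto simp: N_def intro!: Bochner_Integration.integral_nonneg)
    have \<omega>: "0 \<le> \<omega>" using N B s by (auto simp: \<omega>_def)
    have n1: "1 \<le> ?n" by (simp add: DIM_positive Suc_leI)
    have osc: "\<bar>mollify v q r' - mollify v p r\<bar> \<le> \<omega>" if pq: "(p, r) \<in> T z" "(q, r') \<in> T z" for p r q r' z
    proof -
      have "norm ((1 / s) *\<^sub>R (q - p)) \<le> 1"
      proof -
        have "(1 / s) *\<^sub>R (q - p) = ((1 / s) *\<^sub>R (q - x) - z) - ((1 / s) *\<^sub>R (p - x) - z)"
          by (simp add: algebra_simps)
        then have "norm ((1 / s) *\<^sub>R (q - p)) \<le> norm ((1 / s) *\<^sub>R (q - x) - z) + norm ((1 / s) *\<^sub>R (p - x) - z)"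
          by (metis norm_triangle_ineq4)
        moreover have "norm ((1 / s) *\<^sub>R (q - x) - z) < 1 / 2" "norm ((1 / s) *\<^sub>R (p - x) - z) < 1 / 2"
          using pq by (simp_all add: T_def)
        ultimately show ?thesis by linarith
      qed
      then have qp: "norm (q - p) \<le> s" using s by (simp add: divide_le_eq)
      have E: "ball p (4 * ?n * r) \<subseteq> E"
      proof
        fix y assume "y \<in> ball p (4 * ?n * r)"
        then have "norm (y - p) < 4 * ?n * r" by (simp add: dist_norm norm_minus_commute)
        also have "\<dots> \<le> 4 * ?n * s" using pq by (intro mult_left_mono) (auto simp: T_def)
        finally have "norm (y - p) < 4 * ?n * s" .
        moreover have "norm (p - x) \<le> A * s" using pq by (auto simp: T_def)
        ultimately have "norm (y - x) < (A + 4 * ?n) * s"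
          using norm_triangle_ineq[of "y - p" "p - x"] by (simp add: algebra_simps)
        then show "y \<in> E" by (simp add: E_def dist_norm norm_minus_commute)
      qed
      have sub: "cbox (p + t *\<^sub>R (q - p)) (p + t *\<^sub>R (q - p) + (r + t * (r' - r)) *\<^sub>R One) \<subseteq> \<Omega> \<inter> E"
        if "t \<in> {0..1}" for t
      proof -
        \<comment> \<open>The segment moves the corner by at most \<open>s\<close>, and a cube of side at
          most \<open>s\<close> has diameter at most \<open>n * s\<close>; as \<open>s / 2 < r\<close>, the
          ball of radius \<open>4 * n * r\<close> around \<open>p\<close> leaves enough room.\<close>
        have "s + ?n * s \<le> 2 * ?n * s" using n1 s by (simp add: algebra_simps)
        also have "\<dots> < 4 * ?n * r"
          using pq n1 by (auto simp: T_def field_simps)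
        finally have "cbox (p + t *\<^sub>R (q - p)) (p + t *\<^sub>R (q - p) + (r + t * (r' - r)) *\<^sub>R One) \<subseteq> ball p (4 * ?n * r)"
          using that pq qp s by (intro cbox_segment_subset_ball[where \<delta>=s and s=s]) (auto simp: T_def)
        also have "\<dots> \<subseteq> \<Omega> \<inter> E" using E pq by (auto simp: T_def)
        finally show ?thesis .
      qed
      have "\<bar>mollify v q r' - mollify v p r\<bar> \<le> (norm (q - p) + ?n * \<bar>r' - r\<bar>) * (B / (s / 2) ^ DIM('a)) * N"
        unfolding N_def using s pq sub by (intro mollify_segment_bound[OF wg B]) (auto simp: T_def E_def)
      also have "\<dots> \<le> ((1 + ?n) * s) * (B / (s / 2) ^ DIM('a)) * N"
      proof (intro mult_right_mono N)
        have "\<bar>r' - r\<bar> \<le> s" using pq by (auto simp: T_def)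
        then have "?n * \<bar>r' - r\<bar> \<le> ?n * s" by (intro mult_left_mono) auto
        with qp show "norm (q - p) + ?n * \<bar>r' - r\<bar> \<le> (1 + ?n) * s"
          unfolding distrib_right mult_1 by (intro add_mono)
      qed (use B s in auto)
      finally show ?thesis by (simp add: \<omega>_def)
    qed
    have "\<exists>m. \<forall>(p, r)\<in>T z. mollify v p r \<in> cball m \<omega>" for z
    proof (cases "T z = {}")
      case False
      then obtain p r where "(p, r) \<in> T z" by auto
      then show ?thesis using osc by (intro exI[of _ "mollify v p r"]) (auto simp: dist_real_def abs_minus_commute)
    qed auto
    then obtain m where "\<forall>z. \<forall>(p, r)\<in>T z. mollify v p r \<in> cball (m z) \<omega>" by metis
    then have m: "mollify v p r \<in> cball (m z) \<omega>" if "(p, r) \<in> T z" for z p r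
      using that by fast
    define C where "C = (\<Union>z\<in>Z. cball (m z) \<omega>)"
    have "C \<in> sets borel" unfolding C_def using Z(1) by (intro sets.finite_UN) auto
    moreover have "mollify v p r \<in> C"
      if "s / 2 < r" "r \<le> s" "norm (p - x) \<le> A * s" "ball p (4 * real DIM('a) * r) \<subseteq> \<Omega>" for p r
    proof -
      have "(1 / s) *\<^sub>R (p - x) \<in> cball 0 A" using that s by (simp add: divide_le_eq)
      then obtain z where z: "z \<in> Z" "(1 / s) *\<^sub>R (p - x) \<in> ball z (1 / 2)"
        using Z(2) by blast
      then have "norm ((1 / s) *\<^sub>R (p - x) - z) < 1 / 2"
        by (simp only: mem_ball dist_norm norm_minus_commute)
      with z(1)
      show ?thesis using m[of p r z] that by (auto simp: C_def T_def)
    qed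
    moreover have "emeasure lborel C \<le> ennreal (c * s / s ^ DIM('a) * N)"
    proof -
      have "emeasure lborel C \<le> (\<Sum>z\<in>Z. emeasure lborel (cball (m z) \<omega>))"
        unfolding C_def using Z(1) by (intro emeasure_subadditive_finite) auto
      also have "\<dots> = (\<Sum>z\<in>Z. ennreal (2 * \<omega>))"
        using \<omega> by (intro sum.cong refl) (simp add: cball_eq_atLeastAtMost)
      also have "\<dots> = ennreal (card Z * (2 * \<omega>))"
        using \<omega> by (simp add: ennreal_of_nat_eq_real_of_nat ennreal_mult)
      also have "card Z * (2 * \<omega>) = c * s / s ^ DIM('a) * N"
        using s by (simp add: \<omega>_def c_def power_divide field_simps)
      finally show ?thesis .
    qed
    ultimately show "\<exists>C\<in>sets borel.
      (\<forall>p r. s / 2 < r \<longrightarrow> r \<le> s \<longrightarrow> norm (p - x) \<le> A * s \<longrightarrow> ball p (4 * real DIM('a) * r) \<subseteq> \<Omega> \<longrightarrow> mollify v p r \<in> C) \<and>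
      emeasure lborel C \<le> ennreal (c * s / s ^ DIM('a) *
         (LINT y|lborel. indicator (ball x ((A + 4 * real DIM('a)) * s)) y * norm (G y)))"
      unfolding N_def E_def by (intro bexI[of _ C] conjI allI impI)
  qed
qed

text \<open>
  The segment bound with \<open>E = UNIV\<close> makes the averages locally Lipschitz in corner and side.
\<close>

lemma continuous_on_mollify:
  fixes \<Omega> :: "'a::euclidean_space set"
  assumes wg: "integrable_weak_gradient \<Omega> v G"
  shows "continuous_on {(p, r::real). 0 < r \<and> ball p (4 * real DIM('a) * r) \<subseteq> \<Omega>} (\<lambda>(p, r). mollify v p r)"
    (is "continuous_on ?W ?f")
  unfolding continuous_on_iff
proof (intro ballI allI impI)
  let ?n = "real DIM('a)"
  fix z :: "'a \<times> real" and e :: real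
  assume "z \<in> ?W" and e: "0 < e"
  then obtain p r where z: "z = (p, r)" and r: "0 < r" and sub: "ball p (4 * ?n * r) \<subseteq> \<Omega>"
    by auto
  obtain B where B: "B > 0" "\<And>p r (y::'a). 0 < r \<Longrightarrow> mollifier p r y \<le> B / r ^ DIM('a)"
    using mollifier_le by blast
  define M where "M = (B / (r / 2) ^ DIM('a)) * (LINT y|lborel. norm (G y))"
  \<comment> \<open>With a displacement below \<open>r / 4\<close> the cubes have side between \<open>r /
    2\<close> and \<open>5 / 4 * r\<close> and fit into the ball of radius \<open>4 * n * r\<close>; the
    second bound absorbs the Lipschitz constant \<open>(1 + n) * M\<close>.\<close>
  define d where "d = min (r / 4) (e / ((1 + ?n) * M + 1))"
  have n1: "1 \<le> ?n" by (simp add: DIM_positive Suc_leI)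
  have M: "0 \<le> M" using B r by (auto simp: M_def)
  have d: "d > 0" using r e M n1 by (auto simp: d_def intro!: divide_pos_pos add_nonneg_pos)
  have "dist (mollify v q r') (mollify v p r) < e" if "dist (q, r') (p, r) < d" for q r'
  proof -
    have qp: "norm (q - p) < d" and rr: "\<bar>r' - r\<bar> < d"
      using that dist_fst_le[of "(q, r')" "(p, r)"] dist_snd_le[of "(q, r')" "(p, r)"]
      by (auto simp: dist_norm)
    have r': "r / 2 \<le> r'" "r' \<le> 5 / 4 * r" using rr by (simp_all add: d_def abs_real_def split: if_splits)
    have *: "cbox (p + t *\<^sub>R (q - p)) (p + t *\<^sub>R (q - p) + (r + t * (r' - r)) *\<^sub>R One) \<subseteq> \<Omega> \<inter> UNIV"
      if "t \<in> {0..1}" for t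
    proof -
      have "r \<le> ?n * r" using n1 r by simp
      then have "r / 4 + ?n * (5 / 4 * r) < 4 * ?n * r" using r by linarith
      then have "cbox (p + t *\<^sub>R (q - p)) (p + t *\<^sub>R (q - p) + (r + t * (r' - r)) *\<^sub>R One) \<subseteq> ball p (4 * ?n * r)"
        using that r r' qp by (intro cbox_segment_subset_ball[where \<delta>="r / 4" and s="5 / 4 * r"]) (auto simp: d_def)
      with sub show ?thesis by auto
    qed
    have "\<bar>mollify v q r' - mollify v p r\<bar> \<le>
       (norm (q - p) + ?n * \<bar>r' - r\<bar>) * (B / (r / 2) ^ DIM('a)) * (LINT y|lborel. indicator UNIV y * norm (G y))"
      using r r' * by (intro mollify_segment_bound[OF wg B]) auto
    also have "\<dots> = (norm (q - p) + ?n * \<bar>r' - r\<bar>) * M" by (simp add: M_def)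
    also have "\<dots> \<le> (d + ?n * d) * M"
      using qp rr M by (intro mult_right_mono add_mono mult_left_mono) auto
    also have "\<dots> = d * ((1 + ?n) * M)" by (simp add: algebra_simps)
    also have "\<dots> < d * ((1 + ?n) * M + 1)" using d by simp
    also have "\<dots> \<le> (e / ((1 + ?n) * M + 1)) * ((1 + ?n) * M + 1)"
      using M by (intro mult_right_mono) (auto simp: d_def)
    also have "\<dots> = e" using M n1 by (auto simp: add_nonneg_eq_0_iff)
    finally show ?thesis by (simp add: dist_real_def)
  qed
  with d show "\<exists>d>0. \<forall>x'\<in>?W. dist x' z < d \<longrightarrow> dist (?f x') (?f z) < e"
    unfolding z by (intro exI[of _ d]) auto
qed

text \<open>
  A dyadic form of the Riesz kernel of order 1: in dimension \<open>n \<ge> 2\<close> it is comparable to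
  \<open>norm z powr (1 - n)\<close> for \<open>norm z < a * D\<close>. One summand per scale \<open>D / 2 ^ k\<close> is what
  \<open>mollify_shell_image\<close> produces.
\<close>

definition riesz_kernel :: "real \<Rightarrow> real \<Rightarrow> real \<Rightarrow> 'a::euclidean_space \<Rightarrow> ennreal" where
  "riesz_kernel c a D z =
     (\<Sum>k. ennreal (c * (D / 2 ^ k) / (D / 2 ^ k) ^ DIM('a)) * indicator (ball 0 (a * (D / 2 ^ k))) z)"

lemma riesz_kernel_borel [measurable]: "riesz_kernel c a D \<in> borel_measurable borel"
  unfolding riesz_kernel_def[abs_def]
  by (intro borel_measurable_suminf_order borel_measurable_times_ennreal borel_measurable_indicator) auto

definition riesz_potential :: "real \<Rightarrow> real \<Rightarrow> real \<Rightarrow> ('a::euclidean_space \<Rightarrow> 'a) \<Rightarrow> 'a \<Rightarrow> ennreal" where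
  "riesz_potential c a D G x = (\<integral>\<^sup>+y. riesz_kernel c a D (x - y) * ennreal (norm (G y)) \<partial>lborel)"

lemma riesz_potential_eq_suminf:
  fixes G :: "'a::euclidean_space \<Rightarrow> 'a"
  assumes G: "integrable lborel G" and pos: "0 \<le> c" "0 \<le> D"
  shows "riesz_potential c a D G x = (\<Sum>k. ennreal (c * (D / 2 ^ k) / (D / 2 ^ k) ^ DIM('a) *
      (LINT y|lborel. indicator (ball x (a * (D / 2 ^ k))) y * norm (G y))))"
proof -
  have [measurable]: "G \<in> borel_measurable borel" using G by auto
  have ind: "indicator (ball 0 R) (x - y) = (indicator (ball x R) y :: ennreal)" for R y
    by (simp add: indicator_def dist_norm norm_minus_commute)
  have "riesz_potential c a D G x = (\<integral>\<^sup>+y. (\<Sum>k. ennreal (c * (D / 2 ^ k) / (D / 2 ^ k) ^ DIM('a)) *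
      (indicator (ball x (a * (D / 2 ^ k))) y * ennreal (norm (G y)))) \<partial>lborel)"
    unfolding riesz_potential_def riesz_kernel_def ind
    by (simp add: ennreal_suminf_multc[symmetric] mult.assoc del: ennreal_suminf_multc)
  also have "\<dots> = (\<Sum>k. \<integral>\<^sup>+y. ennreal (c * (D / 2 ^ k) / (D / 2 ^ k) ^ DIM('a)) *
      (indicator (ball x (a * (D / 2 ^ k))) y * ennreal (norm (G y))) \<partial>lborel)"
    by (intro nn_integral_suminf borel_measurable_times_ennreal borel_measurable_indicator) auto
  also have "\<dots> = (\<Sum>k. ennreal (c * (D / 2 ^ k) / (D / 2 ^ k) ^ DIM('a) *
      (LINT y|lborel. indicator (ball x (a * (D / 2 ^ k))) y * norm (G y))))"
  proof (rule suminf_cong)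
    fix k
    let ?E = "ball x (a * (D / 2 ^ k))"
    have int: "integrable lborel (\<lambda>y. indicator ?E y * norm (G y))"
      using integrable_mult_indicator[OF _ integrable_norm[OF G], of ?E] by simp
    have "(\<integral>\<^sup>+y. indicator ?E y * ennreal (norm (G y)) \<partial>lborel) = (\<integral>\<^sup>+y. ennreal (indicator ?E y * norm (G y)) \<partial>lborel)"
      by (intro nn_integral_cong) (auto simp: indicator_def)
    also have "\<dots> = ennreal (LINT y|lborel. indicator ?E y * norm (G y))"
      by (rule nn_integral_eq_integral[OF int]) auto
    finally show "(\<integral>\<^sup>+y. ennreal (c * (D / 2 ^ k) / (D / 2 ^ k) ^ DIM('a)) *
      (indicator ?E y * ennreal (norm (G y))) \<partial>lborel) = ennreal (c * (D / 2 ^ k) / (D / 2 ^ k) ^ DIM('a) *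
      (LINT y|lborel. indicator ?E y * norm (G y)))"
      using pos
      by (subst nn_integral_cmult)
        (auto intro!: borel_measurable_times_ennreal borel_measurable_indicator
          simp: ennreal_mult' simp del: times_divide_eq_left)
  qed
  finally show ?thesis .
qed

text \<open>
  A connected set of reals contains the interval between any two of its points, so the measure of any
  set covering it bounds their distance. This is how oscillation bounds on separate cells are added up without
  following a curve from cell to cell.
\<close>

lemma connected_image_distance_le:
  fixes I :: "real set"
  assumes "connected I" "a \<in> I" "b \<in> I" "I \<subseteq> C" "C \<in> sets borel"
  shows "ennreal \<bar>a - b\<bar> \<le> emeasure lborel C"
proof -
  have "{min a b..max a b} \<subseteq> I"
    using assms(1-3) by (metis connected_contains_Icc max_def min_def)
  with assms(4,5) have "emeasure lborel {min a b..max a b} \<le> emeasure lborel C"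
    by (intro emeasure_mono) auto
  then show ?thesis by (auto simp: min_def max_def abs_real_def split: if_splits)
qed

lemma exists_dyadic_shell:
  fixes r D :: real
  assumes "0 < r" "r \<le> D"
  shows "\<exists>k. D / 2 ^ k / 2 < r \<and> r \<le> D / 2 ^ k"
proof -
  obtain m where "D / r < 2 ^ m"
    using real_arch_pow[of 2 "D / r"] by auto
  then have ex: "D / 2 ^ m < r" using assms by (simp add: field_simps)
  define k where "k = (LEAST k. D / 2 ^ k < r)"
  have k: "D / 2 ^ k < r" unfolding k_def using ex by (rule LeastI)
  then obtain j where j: "k = Suc j" using assms by (cases k) auto
  then have "\<not> D / 2 ^ j < r" unfolding k_def by (metis not_less_Least lessI)
  with k j show ?thesis by (intro exI[of _ j]) (auto simp: field_simps)
qed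

text \<open>
  A connected family of cubes, each of side at least proportional to its distance from \<open>x\<close> or from \<open>y\<close>.
  The averages over the family form a connected set of reals. It is covered by the sets that
  \<open>mollify_shell_image\<close> yields for the dyadic scales, once around \<open>x\<close> and once around \<open>y\<close>, and the
  measures of these sets add up to the two potentials.
\<close>

lemma mollify_difference_bound:
  fixes A D :: real
  assumes D: "0 < D"
  shows "\<exists>c\<ge>0. \<forall>\<Omega> v G (x::'a::euclidean_space) y (S::('a \<times> real) set) p0 r0 p1 r1.
     integrable_weak_gradient \<Omega> v G \<longrightarrow> connected S \<longrightarrow>
     (\<forall>(p, r)\<in>S. 0 < r \<and> r \<le> D \<and> ball p (4 * real DIM('a) * r) \<subseteq> \<Omega> \<and> (norm (p - x) \<le> A * r \<or> norm (p - y) \<le> A * r)) \<longrightarrow>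
     (p0, r0) \<in> S \<longrightarrow> (p1, r1) \<in> S \<longrightarrow>
     ennreal \<bar>mollify v p0 r0 - mollify v p1 r1\<bar> \<le>
       riesz_potential c (\<bar>A\<bar> + 4 * real DIM('a)) D G x + riesz_potential c (\<bar>A\<bar> + 4 * real DIM('a)) D G y"
proof -
  let ?n = "real DIM('a)"
  let ?s = "\<lambda>k::nat. D / 2 ^ k"
  obtain c where c: "c \<ge> 0" and shell: "\<forall>\<Omega> v G (x::'a) (s::real). integrable_weak_gradient \<Omega> v G \<longrightarrow> 0 < s \<longrightarrow>
    (\<exists>C\<in>sets borel.
      (\<forall>p r. s / 2 < r \<longrightarrow> r \<le> s \<longrightarrow> norm (p - x) \<le> \<bar>A\<bar> * s \<longrightarrow> ball p (4 * real DIM('a) * r) \<subseteq> \<Omega> \<longrightarrow> mollify v p r \<in> C) \<and>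
      emeasure lborel C \<le> ennreal (c * s / s ^ DIM('a) *
         (LINT y|lborel. indicator (ball x ((\<bar>A\<bar> + 4 * real DIM('a)) * s)) y * norm (G y))))"
    using mollify_shell_image[where 'a='a, of "\<bar>A\<bar>"] by blast
  show ?thesis
  proof (intro exI[of _ c] conjI allI impI c)
    fix \<Omega> v and G :: "'a \<Rightarrow> 'a" and x y :: 'a and S :: "('a \<times> real) set" and p0 r0 p1 r1
    assume wg: "integrable_weak_gradient \<Omega> v G" and S: "connected S"
      and adm: "\<forall>(p, r)\<in>S. 0 < r \<and> r \<le> D \<and> ball p (4 * real DIM('a) * r) \<subseteq> \<Omega> \<and> (norm (p - x) \<le> A * r \<or> norm (p - y) \<le> A * r)"
      and ends: "(p0, r0) \<in> S" "(p1, r1) \<in> S"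
    have s: "0 < ?s k" for k using D by simp
    have G: "integrable lborel G" using wg by (simp add: integrable_weak_gradient_def)
    define Q where "Q z C \<longleftrightarrow> C \<in> sets borel \<and>
      (\<forall>p r. 0 < r \<longrightarrow> r \<le> D \<longrightarrow> norm (p - z) \<le> A * r \<longrightarrow> ball p (4 * real DIM('a) * r) \<subseteq> \<Omega> \<longrightarrow> mollify v p r \<in> C) \<and>
      emeasure lborel C \<le> riesz_potential c (\<bar>A\<bar> + 4 * real DIM('a)) D G z" for z C
    have "\<exists>C. Q z C" for z
    proof -
      define P where "P k C \<longleftrightarrow> C \<in> sets borel \<and>
        (\<forall>p r. ?s k / 2 < r \<longrightarrow> r \<le> ?s k \<longrightarrow> norm (p - z) \<le> \<bar>A\<bar> * ?s k \<longrightarrow> ball p (4 * real DIM('a) * r) \<subseteq> \<Omega> \<longrightarrow> mollify v p r \<in> C) \<and>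
        emeasure lborel C \<le> ennreal (c * ?s k / ?s k ^ DIM('a) *
         (LINT y|lborel. indicator (ball z ((\<bar>A\<bar> + 4 * real DIM('a)) * ?s k)) y * norm (G y)))" for k C
      have "\<exists>C. P k C" for k
        using shell[rule_format, OF wg s[of k], of z] by (simp only: P_def Bex_def)
      then obtain C where "\<And>k. P k (C k)" by metis
      then have C: "\<And>k. C k \<in> sets borel"
        "\<And>k p r. ?s k / 2 < r \<Longrightarrow> r \<le> ?s k \<Longrightarrow> norm (p - z) \<le> \<bar>A\<bar> * ?s k \<Longrightarrow> ball p (4 * real DIM('a) * r) \<subseteq> \<Omega> \<Longrightarrow> mollify v p r \<in> C k"
        "\<And>k. emeasure lborel (C k) \<le> ennreal (c * ?s k / ?s k ^ DIM('a) *
         (LINT y|lborel. indicator (ball z ((\<bar>A\<bar> + 4 * real DIM('a)) * ?s k)) y * norm (G y)))"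
        by (simp_all only: P_def)
      have "mollify v p r \<in> (\<Union>k. C k)"
        if r: "0 < r" "r \<le> D" and p: "norm (p - z) \<le> A * r" "ball p (4 * real DIM('a) * r) \<subseteq> \<Omega>" for p r
      proof -
        obtain k where k: "?s k / 2 < r" "r \<le> ?s k" using exists_dyadic_shell[OF r] by blast
        have "A * r \<le> \<bar>A\<bar> * ?s k" using k r by (intro mult_mono) auto
        then show ?thesis using C(2)[OF k _ p(2)] p(1) by fastforce
      qed
      moreover have "emeasure lborel (\<Union>k. C k) \<le> (\<Sum>k. emeasure lborel (C k))"
        using C(1) by (intro emeasure_subadditive_countably) auto
      moreover have "\<dots> \<le> riesz_potential c (\<bar>A\<bar> + 4 * real DIM('a)) D G z"
        unfolding riesz_potential_eq_suminf[OF G c less_imp_le[OF D]]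
        using C(3) by (intro suminf_le) auto
      moreover have "(\<Union>k. C k) \<in> sets borel" using C(1) by auto
      ultimately show ?thesis unfolding Q_def by (intro exI[of _ "\<Union>k. C k"]) auto
    qed
    then obtain C where "\<And>z. Q z (C z)" by metis
    then have C: "\<And>z. C z \<in> sets borel"
      "\<And>z p r. 0 < r \<Longrightarrow> r \<le> D \<Longrightarrow> norm (p - z) \<le> A * r \<Longrightarrow> ball p (4 * real DIM('a) * r) \<subseteq> \<Omega> \<Longrightarrow> mollify v p r \<in> C z"
      "\<And>z. emeasure lborel (C z) \<le> riesz_potential c (\<bar>A\<bar> + 4 * real DIM('a)) D G z"
      by (simp_all only: Q_def)
    let ?f = "\<lambda>(p, r). mollify v p r"
    have "continuous_on S ?f"
      by (rule continuous_on_subset[OF continuous_on_mollify[OF wg]]) (use adm in auto)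
    then have "connected (?f ` S)" using S by (rule connected_continuous_image)
    moreover have "?f ` S \<subseteq> C x \<union> C y"
      using adm C(2) by fast
    ultimately have "ennreal \<bar>mollify v p0 r0 - mollify v p1 r1\<bar> \<le> emeasure lborel (C x \<union> C y)"
      using ends C(1) by (intro connected_image_distance_le) force+
    also have "\<dots> \<le> emeasure lborel (C x) + emeasure lborel (C y)"
      using C(1) by (intro emeasure_subadditive) auto
    also have "\<dots> \<le> riesz_potential c (\<bar>A\<bar> + 4 * real DIM('a)) D G x + riesz_potential c (\<bar>A\<bar> + 4 * real DIM('a)) D G y"
      using C(3) by (intro add_mono)
    finally show "ennreal \<bar>mollify v p0 r0 - mollify v p1 r1\<bar> \<le>
       riesz_potential c (\<bar>A\<bar> + 4 * real DIM('a)) D G x + riesz_potential c (\<bar>A\<bar> + 4 * real DIM('a)) D G y" .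
  qed
qed

section \<open>The potential on square-integrable functions\<close>

text \<open>
  At scale \<open>s\<close> the kernel has height of order \<open>s / s ^ n\<close> on a ball of volume of order \<open>s ^ n\<close>, so the
  integrals of the summands form a geometric series.
\<close>

lemma nn_integral_riesz_kernel_finite:
  assumes "0 \<le> c" "0 \<le> a" "0 < D"
  shows "(\<integral>\<^sup>+z. riesz_kernel c a D (z::'a::euclidean_space) \<partial>lborel) < \<infinity>"
proof -
  let ?n = "DIM('a)"
  define K where "K = c * D * a ^ ?n * unit_ball_vol (real ?n)"
  have K: "0 \<le> K" using assms by (simp add: K_def)
  have "(\<integral>\<^sup>+z. riesz_kernel c a D (z::'a) \<partial>lborel) =
      (\<Sum>k. \<integral>\<^sup>+z. ennreal (c * (D / 2 ^ k) / (D / 2 ^ k) ^ ?n) * indicator (ball 0 (a * (D / 2 ^ k))) (z::'a) \<partial>lborel)"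
    unfolding riesz_kernel_def
    by (intro nn_integral_suminf borel_measurable_times_ennreal borel_measurable_indicator) auto
  also have "\<dots> = (\<Sum>k. ennreal (K * (1 / 2) ^ k))"
  proof (rule suminf_cong)
    fix k
    let ?s = "D / 2 ^ k"
    have s: "0 < ?s" using assms by simp
    have "(\<integral>\<^sup>+z. ennreal (c * ?s / ?s ^ ?n) * indicator (ball 0 (a * ?s)) (z::'a) \<partial>lborel) =
        ennreal (c * ?s / ?s ^ ?n) * ennreal (unit_ball_vol (real ?n) * (a * ?s) ^ ?n)"
      using assms by (subst nn_integral_cmult_indicator) (auto simp: emeasure_ball)
    also have "\<dots> = ennreal (c * ?s / ?s ^ ?n * (unit_ball_vol (real ?n) * (a * ?s) ^ ?n))"
      using assms s by (intro ennreal_mult'[symmetric]) auto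
    also have "c * ?s / ?s ^ ?n * (unit_ball_vol (real ?n) * (a * ?s) ^ ?n) = c * ?s * unit_ball_vol (real ?n) * a ^ ?n"
      using s by (simp only: power_mult_distrib) (simp add: field_simps)
    also have "\<dots> = K * (1 / 2) ^ k" by (simp add: K_def power_divide)
    finally show "(\<integral>\<^sup>+z. ennreal (c * ?s / ?s ^ ?n) * indicator (ball 0 (a * ?s)) (z::'a) \<partial>lborel) = ennreal (K * (1 / 2) ^ k)" .
  qed
  also have "\<dots> = ennreal (K * (1 / (1 - 1 / 2)))"
    using K by (intro suminf_ennreal_eq sums_mult geometric_sums) auto
  finally show ?thesis by simp
qed

lemma nn_integral_lborel_reflect:
  fixes f :: "'a::euclidean_space \<Rightarrow> ennreal"
  assumes [measurable]: "f \<in> borel_measurable borel"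
  shows "(\<integral>\<^sup>+y. f (x - y) \<partial>lborel) = (\<integral>\<^sup>+y. f y \<partial>lborel)"
proof -
  have "lborel = distr lborel borel (\<lambda>y::'a. x - y)"
    using lborel_affine[of "-1" x] by (simp add: density_1)
  then have "(\<integral>\<^sup>+y. f y \<partial>lborel) = (\<integral>\<^sup>+y. f y \<partial>distr lborel borel (\<lambda>y. x - y))" by simp
  also have "\<dots> = (\<integral>\<^sup>+y. f (x - y) \<partial>lborel)" by (rule nn_integral_distr) auto
  finally show ?thesis by simp
qed

lemma nn_integral_lborel_translate:
  fixes f :: "'a::euclidean_space \<Rightarrow> ennreal"
  assumes [measurable]: "f \<in> borel_measurable borel"
  shows "(\<integral>\<^sup>+x. f (x - y) \<partial>lborel) = (\<integral>\<^sup>+x. f x \<partial>lborel)"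
proof -
  have "lborel = distr lborel borel (\<lambda>x::'a. x - y)"
    using lborel_affine[of 1 "- y"] by (simp add: density_1)
  then have "(\<integral>\<^sup>+x. f x \<partial>lborel) = (\<integral>\<^sup>+x. f x \<partial>distr lborel borel (\<lambda>x. x - y))" by simp
  also have "\<dots> = (\<integral>\<^sup>+x. f (x - y) \<partial>lborel)" by (rule nn_integral_distr) auto
  finally show ?thesis by simp
qed

text \<open>
  Young's inequality. Cauchy-Schwarz with respect to the measure with density \<open>K (x - y)\<close> gives
  \<open>(K * h)\<^sup>2 \<le> k (K * h\<^sup>2)\<close> pointwise, with \<open>k\<close> the integral of \<open>K\<close>, and Tonelli integrates the right-hand side.
\<close>

lemma young_convolution_L1_L2:
  fixes K h :: "'a::euclidean_space \<Rightarrow> ennreal"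
  assumes [measurable]: "K \<in> borel_measurable borel" "h \<in> borel_measurable borel"
  shows "(\<integral>\<^sup>+x. (\<integral>\<^sup>+y. K (x - y) * h y \<partial>lborel)\<^sup>2 \<partial>lborel) \<le> (\<integral>\<^sup>+z. K z \<partial>lborel)\<^sup>2 * (\<integral>\<^sup>+y. (h y)\<^sup>2 \<partial>lborel)"
proof -
  define k where "k = (\<integral>\<^sup>+z. K z \<partial>lborel)"
  have pw: "(\<integral>\<^sup>+y. K (x - y) * h y \<partial>lborel)\<^sup>2 \<le> k * (\<integral>\<^sup>+y. K (x - y) * (h y)\<^sup>2 \<partial>lborel)" for x
  proof -
    let ?N = "density lborel (\<lambda>y. K (x - y))"
    have "(\<integral>\<^sup>+y. 1 * h y \<partial>?N)\<^sup>2 \<le> (\<integral>\<^sup>+y. 1\<^sup>2 \<partial>?N) * (\<integral>\<^sup>+y. (h y)\<^sup>2 \<partial>?N)"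
      by (intro Cauchy_Schwarz_nn_integral) auto
    then show ?thesis
      by (simp add: nn_integral_density emeasure_density nn_integral_lborel_reflect k_def)
  qed
  have "(\<integral>\<^sup>+x. (\<integral>\<^sup>+y. K (x - y) * h y \<partial>lborel)\<^sup>2 \<partial>lborel) \<le> (\<integral>\<^sup>+x. k * (\<integral>\<^sup>+y. K (x - y) * (h y)\<^sup>2 \<partial>lborel) \<partial>lborel)"
    by (intro nn_integral_mono pw)
  also have "\<dots> = k * (\<integral>\<^sup>+x. (\<integral>\<^sup>+y. K (x - y) * (h y)\<^sup>2 \<partial>lborel) \<partial>lborel)"
    by (rule nn_integral_cmult) measurable
  also have "(\<integral>\<^sup>+x. (\<integral>\<^sup>+y. K (x - y) * (h y)\<^sup>2 \<partial>lborel) \<partial>lborel) = (\<integral>\<^sup>+y. (\<integral>\<^sup>+x. K (x - y) * (h y)\<^sup>2 \<partial>lborel) \<partial>lborel)"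
    by (rule lborel_pair.Fubini') measurable
  also have "\<dots> = (\<integral>\<^sup>+y. k * (h y)\<^sup>2 \<partial>lborel)"
    by (simp add: nn_integral_multc nn_integral_lborel_translate k_def)
  also have "\<dots> = k * (\<integral>\<^sup>+y. (h y)\<^sup>2 \<partial>lborel)" by (simp add: nn_integral_cmult)
  finally show ?thesis by (simp add: k_def power2_eq_square mult.assoc)
qed

lemma riesz_potential_borel [measurable]:
  assumes [measurable]: "G \<in> borel_measurable borel"
  shows "riesz_potential c a D G \<in> borel_measurable borel"
  unfolding riesz_potential_def[abs_def] by measurable

section \<open>Recovering a function from its averages\<close>

text \<open>
  Lebesgue differentiation for the functions \<open>\<lambda>y. \<bar>v y - q\<bar>\<close> with rational \<open>q\<close> shows that almost every
  point is a Lebesgue point: choosing \<open>q\<close> close to \<open>v x\<close>, the mean of \<open>\<bar>v y - q\<bar>\<close> over a small cube at \<open>x\<close> is small.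
  The mollifier is at most a constant over the volume of its cube, so its averages converge as well.
\<close>

lemma mollify_tendsto_AE:
  fixes v :: "'a::euclidean_space \<Rightarrow> real"
  assumes v: "integrable lborel v"
  shows "AE x in lborel. ((\<lambda>r. mollify v x r) \<longlongrightarrow> v x) (at_right 0)"
proof -
  have [measurable]: "v \<in> borel_measurable borel" using v by auto
  obtain B where B: "B > 0" "\<And>p r (y::'a). 0 < r \<Longrightarrow> mollifier p r y \<le> B / r ^ DIM('a)"
    using mollifier_le by blast
  have set_int: "set_integrable lborel (cbox a b) (\<lambda>y. \<bar>v y - q\<bar>)" for a b q
  proof -
    have "integrable lborel (\<lambda>y. indicator (cbox a b) y *\<^sub>R v y)"
      using integrable_mult_indicator[of "cbox a b" lborel v] v by simp
    moreover have "integrable lborel (\<lambda>y. q * indicator (cbox a b) y)"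
      by (intro integrable_mult_right integrable_real_indicator emeasure_lborel_cbox_finite) auto
    ultimately have "integrable lborel (\<lambda>y. \<bar>indicator (cbox a b) y *\<^sub>R v y - q * indicator (cbox a b) y\<bar>)"
      by (intro integrable_abs Bochner_Integration.integrable_diff)
    also have "(\<lambda>y. \<bar>indicator (cbox a b) y *\<^sub>R v y - q * indicator (cbox a b) y\<bar>) =
        (\<lambda>y. indicator (cbox a b) y *\<^sub>R \<bar>v y - q\<bar>)"
      by (auto simp: indicator_def)
    finally show ?thesis by (simp only: set_integrable_def)
  qed
  have "\<exists>N. negligible N \<and> (\<forall>x e. x \<notin> N \<longrightarrow> 0 < e \<longrightarrow> (\<exists>d>0. \<forall>h. 0 < h \<and> h < d \<longrightarrow>
      norm (integral (cbox x (x + h *\<^sub>R One)) (\<lambda>y. \<bar>v y - q\<bar>) /\<^sub>R h ^ DIM('a) - \<bar>v x - q\<bar>) < e))" for q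
  proof -
    have "(\<lambda>y. \<bar>v y - q\<bar>) integrable_on cbox a b" for a b
      using set_borel_integral_eq_integral(1)[OF set_int] .
    from integrable_ccontinuous_explicit[OF this] obtain N where "negligible N"
      "\<And>x e. x \<notin> N \<Longrightarrow> 0 < e \<Longrightarrow> \<exists>d>0. \<forall>h. 0 < h \<and> h < d \<longrightarrow>
      norm (integral (cbox x (x + h *\<^sub>R One)) (\<lambda>y. \<bar>v y - q\<bar>) /\<^sub>R h ^ DIM('a) - \<bar>v x - q\<bar>) < e"
      by blast
    then show ?thesis by (intro exI[of _ N]) simp
  qed
  then obtain N where N: "\<And>q. negligible (N q)" and leb: "\<And>q x e. x \<notin> N q \<Longrightarrow> 0 < e \<Longrightarrow> \<exists>d>0. \<forall>h. 0 < h \<and> h < d \<longrightarrow>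
      norm (integral (cbox x (x + h *\<^sub>R One)) (\<lambda>y. \<bar>v y - q\<bar>) /\<^sub>R h ^ DIM('a) - \<bar>v x - q\<bar>) < e"
    by metis
  have "negligible (\<Union>q\<in>\<rat>. N q)"
    by (intro negligible_countable_Union countable_image countable_rat) (use N in auto)
  then have "AE x in lebesgue. x \<notin> (\<Union>q\<in>\<rat>. N q)"
    by (simp only: negligible_iff_null_sets) (rule AE_not_in)
  then have "AE x in lborel. x \<notin> (\<Union>q\<in>\<rat>. N q)"
    by (simp only: AE_completion_iff)
  then show ?thesis
  proof eventually_elim
    fix x assume x: "x \<notin> (\<Union>q\<in>\<rat>. N q)"
    show "((\<lambda>r. mollify v x r) \<longlongrightarrow> v x) (at_right 0)"
    proof (rule tendstoI)
      fix e :: real assume e: "0 < e"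
      \<comment> \<open>The error is at most \<open>B * (2 * \<eta>)\<close> for the mean of \<open>\<bar>v
        y - q\<bar>\<close> and \<open>\<eta>\<close> for replacing \<open>v x\<close> by
        \<open>q\<close>.\<close>
      define \<eta> where "\<eta> = e / (2 * B + 1)"
      have \<eta>: "0 < \<eta>" using e B by (simp add: \<eta>_def)
      obtain q where q: "q \<in> \<rat>" "v x < q" "q < v x + \<eta>"
        using Rats_dense_in_real[of "v x" "v x + \<eta>"] \<eta> by auto
      obtain d where d: "d > 0" "\<And>h. 0 < h \<Longrightarrow> h < d \<Longrightarrow>
          norm (integral (cbox x (x + h *\<^sub>R One)) (\<lambda>y. \<bar>v y - q\<bar>) /\<^sub>R h ^ DIM('a) - \<bar>v x - q\<bar>) < \<eta>"
        using leb[of x q \<eta>] x q \<eta> by blast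
      have "dist (mollify v x h) (v x) < e" if h: "0 < h" "h < d" for h
      proof -
        let ?m = "mollifier x h" and ?C = "cbox x (x + h *\<^sub>R One)"
        have m: "integrable lborel ?m" "(LINT y|lborel. ?m y) = 1"
          using mollifier_integral[OF h(1), of x] by (auto simp: has_bochner_integral_iff)
        have m0: "0 \<le> ?m y" "\<bar>?m y\<bar> \<le> B / h ^ DIM('a)" for y
          using mollifier_nonneg[OF h(1), of x y] B(2)[OF h(1), of x y] by auto
        have vm: "integrable lborel (\<lambda>y. v y * ?m y)"
          by (rule integrable_mult_bounded[OF v _ m0(2)]) simp
        have "mollify v x h - q = (LINT y|lborel. v y * ?m y - q * ?m y)"
          using vm m by (simp add: mollify_def)
        also have "\<bar>\<dots>\<bar> \<le> (LINT y|lborel. \<bar>v y * ?m y - q * ?m y\<bar>)"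
          by (rule integral_abs_bound)
        also have "\<dots> \<le> (LINT y|lborel. (B / h ^ DIM('a)) * (indicator ?C y *\<^sub>R \<bar>v y - q\<bar>))"
        proof (rule integral_mono)
          show "integrable lborel (\<lambda>y. (B / h ^ DIM('a)) * (indicator ?C y *\<^sub>R \<bar>v y - q\<bar>))"
            using set_int[of x "x + h *\<^sub>R One" q] unfolding set_integrable_def by (rule integrable_mult_right)
          show "\<bar>v y * ?m y - q * ?m y\<bar> \<le> (B / h ^ DIM('a)) * (indicator ?C y *\<^sub>R \<bar>v y - q\<bar>)" for y
          proof (cases "y \<in> ?C")
            case True
            have "\<bar>v y * ?m y - q * ?m y\<bar> = \<bar>?m y\<bar> * \<bar>v y - q\<bar>"
              by (simp add: abs_mult[symmetric] algebra_simps)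
            also have "\<dots> \<le> (B / h ^ DIM('a)) * \<bar>v y - q\<bar>"
              by (rule mult_right_mono[OF m0(2)]) simp
            finally show ?thesis using True by simp
          next
            case False
            then show ?thesis by (simp add: mollifier_eq_0[OF h(1)])
          qed
        qed (use vm m in auto)
        also have "\<dots> = B * (integral ?C (\<lambda>y. \<bar>v y - q\<bar>) /\<^sub>R h ^ DIM('a))"
          using set_borel_integral_eq_integral(2)[OF set_int, of x "x + h *\<^sub>R One" q]
          by (simp add: set_lebesgue_integral_def divide_inverse)
        also have "\<dots> \<le> B * (2 * \<eta>)"
        proof (rule mult_left_mono)
          have "\<bar>v x - q\<bar> < \<eta>" using q by linarith
          then show "integral ?C (\<lambda>y. \<bar>v y - q\<bar>) /\<^sub>R h ^ DIM('a) \<le> 2 * \<eta>"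
            using d(2)[OF h] unfolding real_norm_def by linarith
        qed (use B in simp)
        finally have "\<bar>mollify v x h - q\<bar> \<le> B * (2 * \<eta>)" .
        then have "\<bar>mollify v x h - v x\<bar> < B * (2 * \<eta>) + \<eta>" using q by linarith
        also have "\<dots> = (2 * B + 1) * \<eta>" by (simp add: algebra_simps)
        also have "\<dots> = e" using B by (simp add: \<eta>_def)
        finally show ?thesis by (simp add: dist_real_def)
      qed
      then show "\<forall>\<^sub>F r in at_right 0. dist (mollify v x r) (v x) < e"
        using d(1) unfolding eventually_at_right_field by blast
    qed
  qed
qed

section \<open>Families of cubes in uniform domains\<close>

text \<open>
  A ball that misses the frontier of \<open>\<Omega>\<close> but meets \<open>\<Omega>\<close> is contained in it, by connectedness.
\<close>

lemma ball_subset_of_infdist_frontier: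
  fixes p :: "'a::euclidean_space"
  assumes "open \<Omega>" "p \<in> closure \<Omega>" "0 < \<rho>" "\<rho> \<le> infdist p (frontier \<Omega>)"
  shows "ball p \<rho> \<subseteq> \<Omega>"
proof -
  have disj: "ball p \<rho> \<inter> frontier \<Omega> = {}"
    using assms(4) infdist_le[of _ "frontier \<Omega>" p] by (force simp: dist_commute)
  then have "p \<in> \<Omega>"
    using assms by (auto simp: frontier_def interior_open)
  then show ?thesis
    using disj connected_Int_frontier[of "ball p \<rho>" \<Omega>] assms(3) centre_in_ball[of p \<rho>] connected_ball
    by blast
qed

text \<open>
  The cigar around a uniform curve from \<open>x\<close> to \<open>y\<close>, as a family of admissible cubes for
  \<open>mollify_difference_bound\<close>. At the point \<open>\<gamma> t\<close> the side is a small multiple of the distance to the nearer end, plus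
  \<open>\<epsilon>\<close>; so the sides at both ends are \<open>\<epsilon>\<close>, and a ball of radius \<open>N\<close> times the side has to fit into \<open>\<Omega>\<close>. The cigar
  condition pays for the first summand. For the second, the distance to the frontier is bounded below along the
  whole curve, near the ends because \<open>x\<close> and \<open>y\<close> are interior points.
\<close>

lemma uniform_domain_connected_family:
  fixes \<Omega> :: "'a::euclidean_space set" and M R N :: real
  assumes ud: "uniform_domain M \<Omega>" and sub: "\<Omega> \<subseteq> ball 0 R" and N: "1 \<le> N"
    and xy: "x \<in> \<Omega>" "y \<in> \<Omega>"
  shows "\<exists>\<epsilon>0>0. \<forall>\<epsilon>. 0 < \<epsilon> \<longrightarrow> \<epsilon> < \<epsilon>0 \<longrightarrow> (\<exists>S. connected S \<and> (x, \<epsilon>) \<in> S \<and> (y, \<epsilon>) \<in> S \<and>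
    (\<forall>(p, r)\<in>S. 0 < r \<and> r \<le> 2 * R + 1 \<and> ball p (N * r) \<subseteq> \<Omega> \<and>
      (norm (p - x) \<le> 2 * M * N * r \<or> norm (p - y) \<le> 2 * M * N * r)))"
proof -
  have M: "M > 1" and op: "open \<Omega>"
    using ud by (auto simp: uniform_domain_def is_domain_def)
  have cl: "closure \<Omega> \<subseteq> cball 0 R"
    using sub ball_subset_cball closed_cball by (meson closure_minimal order_trans)
  have fr: "frontier \<Omega> \<noteq> {}"
    using xy sub bounded_subset[OF bounded_ball sub] frontier_eq_empty[of \<Omega>] not_bounded_UNIV[where 'a='a] by auto
  obtain \<gamma> where \<gamma>: "path \<gamma>" "path_image \<gamma> \<subseteq> closure \<Omega>" "pathstart \<gamma> = x" "pathfinish \<gamma> = y"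
    and cig: "\<And>t. t \<in> {0..1} \<Longrightarrow> infdist (\<gamma> t) (frontier \<Omega>) \<ge> 1 / M * min (dist (\<gamma> t) x) (dist (\<gamma> t) y)"
    using ud fr xy closure_subset[of \<Omega>] unfolding uniform_domain_def rectifiable_path_def by (meson subsetD)
  let ?d = "\<lambda>p. infdist p (frontier \<Omega>)"
  define \<delta> where "\<delta> = min (?d x) (?d y)"
  have dpos: "0 < ?d z" if "z \<in> \<Omega>" for z
  proof -
    have "z \<notin> frontier \<Omega>" using that op by (simp add: frontier_def interior_open)
    then show ?thesis
      using fr in_closed_iff_infdist_zero[OF frontier_closed fr, of z] infdist_nonneg[of z "frontier \<Omega>"] by fastforce
  qed
  have \<delta>: "0 < \<delta>" using dpos xy by (simp add: \<delta>_def)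
  define m where "m t = min (dist (\<gamma> t) x) (dist (\<gamma> t) y)" for t
  have m0: "0 \<le> m t" for t by (simp add: m_def)
  \<comment> \<open>The distance to the frontier is at least \<open>\<delta> - m t\<close> by the triangle
    inequality and at least \<open>m t / M\<close> by the cigar condition.\<close>
  have far: "\<delta> \<le> (1 + M) * ?d (\<gamma> t)" if "t \<in> {0..1}" for t
  proof -
    have "?d x \<le> ?d (\<gamma> t) + dist x (\<gamma> t)" "?d y \<le> ?d (\<gamma> t) + dist y (\<gamma> t)"
      by (rule infdist_triangle)+
    then have "\<delta> \<le> ?d (\<gamma> t) + m t"
      unfolding \<delta>_def m_def min_def by (auto simp: dist_commute)
    moreover have "m t \<le> M * ?d (\<gamma> t)"
      using cig[OF that] M by (simp add: m_def field_simps)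
    ultimately show ?thesis by (simp add: algebra_simps)
  qed
  \<comment> \<open>Half of the distance to the frontier is reserved for \<open>N * \<epsilon>\<close>, the
    other half for \<open>m t / (2 * M)\<close>; the bound 1 keeps the sides below \<open>2 * R +
    1\<close>.\<close>
  define \<epsilon>0 where "\<epsilon>0 = min 1 (\<delta> / (2 * N * (1 + M)))"
  have \<epsilon>0: "0 < \<epsilon>0" using \<delta> N M by (simp add: \<epsilon>0_def)
  have "\<exists>S. connected S \<and> (x, \<epsilon>) \<in> S \<and> (y, \<epsilon>) \<in> S \<and>
    (\<forall>(p, r)\<in>S. 0 < r \<and> r \<le> 2 * R + 1 \<and> ball p (N * r) \<subseteq> \<Omega> \<and>
      (norm (p - x) \<le> 2 * M * N * r \<or> norm (p - y) \<le> 2 * M * N * r))"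
    if \<epsilon>: "0 < \<epsilon>" "\<epsilon> < \<epsilon>0" for \<epsilon>
  proof -
    define r where "r t = m t / (2 * M * N) + \<epsilon>" for t
    define S where "S = (\<lambda>t. (\<gamma> t, r t)) ` {0..1}"
    have "continuous_on {0..1} (\<lambda>t. (\<gamma> t, r t))"
      using \<gamma>(1) N M unfolding r_def m_def path_def by (intro continuous_intros) auto
    then have "connected S" unfolding S_def by (rule connected_continuous_image) auto
    moreover have "(\<gamma> 0, r 0) \<in> S" "(\<gamma> 1, r 1) \<in> S" by (auto simp: S_def)
    then have "(x, \<epsilon>) \<in> S" "(y, \<epsilon>) \<in> S"
      using \<gamma>(3,4) by (auto simp: pathstart_def pathfinish_def r_def m_def)
    moreover have "0 < r t \<and> r t \<le> 2 * R + 1 \<and> ball (\<gamma> t) (N * r t) \<subseteq> \<Omega> \<and>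
      (norm (\<gamma> t - x) \<le> 2 * M * N * r t \<or> norm (\<gamma> t - y) \<le> 2 * M * N * r t)" if t: "t \<in> {0..1}" for t
    proof (intro conjI)
      have MN: "1 \<le> 2 * M * N" using M N mult_mono[of 1 M 1 N] by simp
      show r0: "0 < r t" using \<epsilon> m0[of t] MN by (auto simp: r_def intro!: add_nonneg_pos)
      have pt: "\<gamma> t \<in> closure \<Omega>" using \<gamma>(2) t by (auto simp: path_image_def)
      have "m t \<le> dist (\<gamma> t) x" by (simp add: m_def)
      also have "\<dots> \<le> norm (\<gamma> t) + norm x" by (simp add: dist_norm norm_triangle_ineq4)
      also have "\<dots> \<le> R + R" using pt cl xy sub by (intro add_mono) (auto simp: less_imp_le)
      finally have "m t \<le> 2 * R" by simp
      moreover have "m t / (2 * M * N) \<le> m t" using MN m0[of t] by (simp add: divide_le_eq mult_le_cancel_left1)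
      ultimately show "r t \<le> 2 * R + 1" using \<epsilon> by (auto simp: r_def \<epsilon>0_def)
      define w where "w = m t / M"
      have "N * r t = w / 2 + N * \<epsilon>" unfolding w_def using N M by (simp add: r_def field_simps)
      moreover have "w \<le> ?d (\<gamma> t)" unfolding w_def using cig[OF t] by (simp add: m_def)
      moreover have "N * \<epsilon> \<le> ?d (\<gamma> t) / 2"
      proof -
        have "\<epsilon> \<le> \<delta> / (2 * N * (1 + M))" using \<epsilon> by (simp add: \<epsilon>0_def)
        moreover have "0 < 2 * N * (1 + M)" using N M by simp
        ultimately have "2 * N * \<epsilon> * (1 + M) \<le> \<delta>" by (simp only: pos_le_divide_eq mult_ac)
        also have "\<dots> \<le> ?d (\<gamma> t) * (1 + M)" using far[OF t] by (simp add: mult.commute)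
        finally show ?thesis using M by simp
      qed
      ultimately have "N * r t \<le> ?d (\<gamma> t)" by linarith
      then show "ball (\<gamma> t) (N * r t) \<subseteq> \<Omega>"
        using r0 N by (intro ball_subset_of_infdist_frontier[OF op pt]) auto
      have "m t \<le> 2 * M * N * r t" using MN \<epsilon> M N by (simp add: r_def distrib_left)
      then show "norm (\<gamma> t - x) \<le> 2 * M * N * r t \<or> norm (\<gamma> t - y) \<le> 2 * M * N * r t"
        by (auto simp: m_def min_def dist_norm split: if_splits)
    qed
    then have "\<forall>(p, r)\<in>S. 0 < r \<and> r \<le> 2 * R + 1 \<and> ball p (N * r) \<subseteq> \<Omega> \<and>
      (norm (p - x) \<le> 2 * M * N * r \<or> norm (p - y) \<le> 2 * M * N * r)"
      by (auto simp: S_def)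
    ultimately show ?thesis by blast
  qed
  with \<epsilon>0 show ?thesis by blast
qed

section \<open>From a two-point estimate to a Poincare inequality\<close>

lemma ennreal_power2_add_le:
  fixes a b :: ennreal
  shows "(a + b)\<^sup>2 \<le> 2 * a\<^sup>2 + 2 * b\<^sup>2"
proof (cases a b rule: ennreal2_cases)
  case (real_real x y)
  have "(x + y)\<^sup>2 \<le> 2 * x\<^sup>2 + 2 * y\<^sup>2"
    using sum_squares_ge_zero[of "x - y" 0] by (simp add: power2_eq_square algebra_simps)
  then have "ennreal ((x + y)\<^sup>2) \<le> ennreal (2 * x\<^sup>2 + 2 * y\<^sup>2)" by (rule ennreal_leI)
  moreover have "(ennreal x + ennreal y)\<^sup>2 = ennreal ((x + y)\<^sup>2)"
    using real_real by (simp add: ennreal_power ennreal_plus[symmetric] del: ennreal_plus)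
  moreover have "2 * (ennreal x)\<^sup>2 + 2 * (ennreal y)\<^sup>2 = ennreal (2 * x\<^sup>2 + 2 * y\<^sup>2)"
    using real_real by (simp add: ennreal_power ennreal_mult)
  ultimately show ?thesis using real_real by simp
qed (auto simp: power2_eq_square)

text \<open>
  Since \<open>v\<close> has mean zero, \<open>v x\<close> is the mean over \<open>y\<close> of \<open>v x - v y\<close>, hence \<open>\<bar>v x\<bar>\<close> is at most \<open>H x\<close>
  plus the mean of \<open>H\<close>; squaring and Cauchy-Schwarz give the factor 4. The total mass cancels, so the bound
  is independent of the size of the domain.
\<close>

lemma mean_zero_L2_bound:
  fixes v :: "'a \<Rightarrow> real" and H :: "'a \<Rightarrow> ennreal"
  assumes fin: "finite_measure N" and nz: "emeasure N (space N) \<noteq> 0"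
    and v: "integrable N v" "(LINT x|N. v x) = 0"
    and [measurable]: "H \<in> borel_measurable N"
    and two_point: "AE x in N. AE y in N. ennreal \<bar>v x - v y\<bar> \<le> H x + H y"
  shows "(\<integral>\<^sup>+x. ennreal ((v x)\<^sup>2) \<partial>N) \<le> 4 * (\<integral>\<^sup>+x. (H x)\<^sup>2 \<partial>N)"
proof -
  interpret finite_measure N by (rule fin)
  define \<mu> where "\<mu> = emeasure N (space N)"
  define J where "J = (\<integral>\<^sup>+x. H x \<partial>N)"
  define Q where "Q = (\<integral>\<^sup>+x. (H x)\<^sup>2 \<partial>N)"
  have [measurable]: "v \<in> borel_measurable N" using v by auto
  have \<mu>: "\<mu> \<noteq> 0" "\<mu> \<noteq> top" "\<mu> = ennreal (measure N (space N))"
    using nz by (auto simp: \<mu>_def emeasure_eq_measure)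
  have "(\<integral>\<^sup>+x. H x * 1 \<partial>N)\<^sup>2 \<le> (\<integral>\<^sup>+x. (H x)\<^sup>2 \<partial>N) * (\<integral>\<^sup>+x. 1\<^sup>2 \<partial>N)"
    by (rule Cauchy_Schwarz_nn_integral) auto
  then have J: "J\<^sup>2 \<le> Q * \<mu>" by (simp add: J_def Q_def \<mu>_def)
  have "AE x in N. \<mu>\<^sup>2 * ennreal ((v x)\<^sup>2) \<le> 2 * \<mu>\<^sup>2 * (H x)\<^sup>2 + 2 * J\<^sup>2"
    using two_point
  proof eventually_elim
    fix x assume x: "AE y in N. ennreal \<bar>v x - v y\<bar> \<le> H x + H y"
    have "(LINT y|N. v x - v y) = measure N (space N) * v x"
      using v by simp
    then have "ennreal \<bar>v x\<bar> * \<mu> = ennreal (norm (LINT y|N. v x - v y))"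
      by (simp add: \<mu>(3) ennreal_mult'' abs_mult mult.commute)
    also have "\<dots> \<le> (\<integral>\<^sup>+y. ennreal (norm (v x - v y)) \<partial>N)"
      using v by (intro integral_norm_bound_ennreal) auto
    also have "\<dots> \<le> (\<integral>\<^sup>+y. H x + H y \<partial>N)"
      using x by (intro nn_integral_mono_AE) simp
    also have "\<dots> = H x * \<mu> + J" by (subst nn_integral_add) (auto simp: \<mu>_def J_def)
    finally have "(ennreal \<bar>v x\<bar> * \<mu>)\<^sup>2 \<le> (H x * \<mu> + J)\<^sup>2" by (rule power_mono_ennreal)
    also have "\<dots> \<le> 2 * (H x * \<mu>)\<^sup>2 + 2 * J\<^sup>2" by (rule ennreal_power2_add_le)
    finally show "\<mu>\<^sup>2 * ennreal ((v x)\<^sup>2) \<le> 2 * \<mu>\<^sup>2 * (H x)\<^sup>2 + 2 * J\<^sup>2"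
      by (simp add: power_mult_distrib ennreal_power mult_ac)
  qed
  then have "(\<integral>\<^sup>+x. \<mu>\<^sup>2 * ennreal ((v x)\<^sup>2) \<partial>N) \<le> (\<integral>\<^sup>+x. 2 * \<mu>\<^sup>2 * (H x)\<^sup>2 + 2 * J\<^sup>2 \<partial>N)"
    by (rule nn_integral_mono_AE)
  also have "\<dots> = 2 * \<mu>\<^sup>2 * Q + 2 * J\<^sup>2 * \<mu>"
    by (subst nn_integral_add) (auto simp: Q_def \<mu>_def nn_integral_cmult)
  also have "\<dots> \<le> 2 * \<mu>\<^sup>2 * Q + 2 * (Q * \<mu>) * \<mu>"
    using J by (intro add_left_mono mult_right_mono mult_left_mono) auto
  also have "\<dots> = 2 * (\<mu>\<^sup>2 * Q) + 2 * (\<mu>\<^sup>2 * Q)" by (simp add: power2_eq_square mult_ac)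
  also have "\<dots> = 4 * (\<mu>\<^sup>2 * Q)" unfolding distrib_right[symmetric] by simp
  also have "\<dots> = \<mu>\<^sup>2 * (4 * Q)" by (simp add: mult_ac)
  finally have "\<mu>\<^sup>2 * (\<integral>\<^sup>+x. ennreal ((v x)\<^sup>2) \<partial>N) \<le> \<mu>\<^sup>2 * (4 * Q)"
    by (simp add: nn_integral_cmult)
  moreover have "\<mu>\<^sup>2 \<noteq> 0" "\<mu>\<^sup>2 \<noteq> top" using \<mu>(1,2) by (auto simp: power_eq_top_ennreal)
  ultimately show ?thesis by (simp add: ennreal_mult_le_mult_iff Q_def)
qed

section \<open>Borel representatives\<close>

lemma lebesgue_on_borel_representative:
  fixes f :: "'a::euclidean_space \<Rightarrow> 'b::euclidean_space"
  assumes \<Omega>: "\<Omega> \<in> sets borel" and f: "f \<in> borel_measurable (lebesgue_on \<Omega>)"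
  shows "\<exists>w\<in>borel_measurable borel. (\<forall>x. x \<notin> \<Omega> \<longrightarrow> w x = 0) \<and> (AE x in lborel. x \<in> \<Omega> \<longrightarrow> w x = f x)"
proof -
  have "(\<lambda>x. indicator \<Omega> x *\<^sub>R f x) \<in> borel_measurable lebesgue"
    using f \<Omega> borel_measurable_restrict_space_iff[of \<Omega> lebesgue f] by simp
  then have "\<exists>g\<in>borel_measurable lborel. AE x in lborel. (indicator \<Omega> x *\<^sub>R f x) \<bullet> b = g x" for b
    by (intro completion_ex_borel_measurable_real borel_measurable_inner borel_measurable_const)
  then obtain g where g: "\<And>b. g b \<in> borel_measurable lborel" "\<And>b. AE x in lborel. (indicator \<Omega> x *\<^sub>R f x) \<bullet> b = g b x"
    by metis
  define w where "w x = indicator \<Omega> x *\<^sub>R (\<Sum>b\<in>Basis. g b x *\<^sub>R b)" for x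
  have [measurable]: "g b \<in> borel_measurable borel" for b using g(1)[of b] by simp
  have "w \<in> borel_measurable borel" unfolding w_def[abs_def] using \<Omega> by measurable
  moreover have "AE x in lborel. x \<in> \<Omega> \<longrightarrow> w x = f x"
  proof -
    have "AE x in lborel. \<forall>b\<in>Basis. (indicator \<Omega> x *\<^sub>R f x) \<bullet> b = g b x"
      using g(2) by (intro AE_ball_countable[THEN iffD2]) (auto intro: countable_finite)
    then show ?thesis
    proof eventually_elim
      case (elim x)
      then have "x \<in> \<Omega> \<Longrightarrow> w x = (\<Sum>b\<in>Basis. (f x \<bullet> b) *\<^sub>R b)"
        by (simp add: w_def)
      then show ?case by (simp add: euclidean_representation)
    qed
  qed
  ultimately show ?thesis by (intro bexI[of _ w]) (auto simp: w_def)
qed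

lemma integral_lebesgue_on_eq_lborel:
  fixes f w :: "'a::euclidean_space \<Rightarrow> 'b::euclidean_space"
  assumes \<Omega>: "\<Omega> \<in> sets borel" and f: "f \<in> borel_measurable (lebesgue_on \<Omega>)" and w: "w \<in> borel_measurable borel"
    and zero: "\<And>x. x \<notin> \<Omega> \<Longrightarrow> w x = 0" and ae: "AE x in lborel. x \<in> \<Omega> \<longrightarrow> w x = f x"
  shows "(LINT x|lebesgue_on \<Omega>. f x) = (LINT x|lborel. w x)"
    and "integrable (lebesgue_on \<Omega>) f \<longleftrightarrow> integrable lborel w"
proof -
  have m: "(\<lambda>x. indicator \<Omega> x *\<^sub>R f x) \<in> borel_measurable lebesgue"
    using f \<Omega> borel_measurable_restrict_space_iff[of \<Omega> lebesgue f] by simp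
  have w': "w \<in> borel_measurable lborel" using w by simp
  have eq: "AE x in lebesgue. indicator \<Omega> x *\<^sub>R f x = w x"
    unfolding AE_completion_iff using ae by eventually_elim (auto simp: indicator_def zero)
  have "(LINT x|lebesgue_on \<Omega>. f x) = (LINT x|lebesgue. indicator \<Omega> x *\<^sub>R f x)"
    using \<Omega> by (intro integral_restrict_space) auto
  also have "\<dots> = (LINT x|lebesgue. w x)"
    by (rule integral_cong_AE[OF m measurable_completion[OF w'] eq])
  also have "\<dots> = (LINT x|lborel. w x)" by (rule integral_completion[OF w'])
  finally show "(LINT x|lebesgue_on \<Omega>. f x) = (LINT x|lborel. w x)" .
  have "integrable (lebesgue_on \<Omega>) f \<longleftrightarrow> integrable lebesgue (\<lambda>x. indicator \<Omega> x *\<^sub>R f x)"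
    using \<Omega> by (intro integrable_restrict_space) auto
  also have "\<dots> \<longleftrightarrow> integrable lebesgue w"
    by (rule integrable_cong_AE[OF m measurable_completion[OF w'] eq])
  also have "\<dots> \<longleftrightarrow> integrable lborel w" by (rule integrable_completion[OF w'])
  finally show "integrable (lebesgue_on \<Omega>) f \<longleftrightarrow> integrable lborel w" .
qed

text \<open>
  On a bounded set square integrability implies integrability, because \<open>t \<le> 1 + t\<^sup>2\<close>.
\<close>

lemma square_integrable_representative:
  fixes f :: "'a::euclidean_space \<Rightarrow> 'b::euclidean_space"
  assumes \<Omega>: "open \<Omega>" "bounded \<Omega>" and f: "square_integrable \<Omega> f"
  shows "\<exists>w. integrable lborel w \<and> integrable lborel (\<lambda>x. (norm (w x))\<^sup>2) \<and> (\<forall>x. x \<notin> \<Omega> \<longrightarrow> w x = 0) \<and>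
    (AE x in lborel. x \<in> \<Omega> \<longrightarrow> w x = f x) \<and>
    (LINT x|lebesgue_on \<Omega>. (norm (f x))\<^sup>2) = (LINT x|lborel. (norm (w x))\<^sup>2)"
proof -
  have B: "\<Omega> \<in> sets borel" using \<Omega> by auto
  have fm [measurable]: "f \<in> borel_measurable (lebesgue_on \<Omega>)" and fi: "integrable (lebesgue_on \<Omega>) (\<lambda>x. (norm (f x))\<^sup>2)"
    using f by (auto simp: square_integrable_def)
  obtain w where w [measurable]: "w \<in> borel_measurable borel" and z: "\<And>x. x \<notin> \<Omega> \<Longrightarrow> w x = 0"
    and ae: "AE x in lborel. x \<in> \<Omega> \<longrightarrow> w x = f x"
    using lebesgue_on_borel_representative[OF B fm] by blast
  have ae2: "AE x in lborel. x \<in> \<Omega> \<longrightarrow> (norm (w x))\<^sup>2 = (norm (f x))\<^sup>2"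
    using ae by eventually_elim auto
  have sq: "(LINT x|lebesgue_on \<Omega>. (norm (f x))\<^sup>2) = (LINT x|lborel. (norm (w x))\<^sup>2)"
      "integrable (lebesgue_on \<Omega>) (\<lambda>x. (norm (f x))\<^sup>2) \<longleftrightarrow> integrable lborel (\<lambda>x. (norm (w x))\<^sup>2)"
    by (rule integral_lebesgue_on_eq_lborel[OF B _ _ _ ae2]; use z in simp)+
  have w2: "integrable lborel (\<lambda>x. (norm (w x))\<^sup>2)" using sq(2) fi by simp
  have "emeasure lborel \<Omega> < \<infinity>" using emeasure_bounded_finite[OF \<Omega>(2)] by simp
  then have "integrable lborel (\<lambda>x. indicator \<Omega> x + (norm (w x))\<^sup>2 :: real)"
    using B w2 by (intro Bochner_Integration.integrable_add integrable_real_indicator) auto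
  then have "integrable lborel w"
  proof (rule Bochner_Integration.integrable_bound)
    show "AE x in lborel. norm (w x) \<le> norm (indicator \<Omega> x + (norm (w x))\<^sup>2 :: real)"
    proof (rule AE_I2)
      fix x
      have "norm (w x) \<le> 1 + (norm (w x))\<^sup>2"
        using zero_le_power2[of "norm (w x) - 1"] norm_ge_zero[of "w x"]
        unfolding power2_diff power_one mult_1_right by linarith
      then show "norm (w x) \<le> norm (indicator \<Omega> x + (norm (w x))\<^sup>2 :: real)"
        using z[of x] by (auto simp: indicator_def)
    qed
  qed simp
  with w2 z ae sq(1) show ?thesis by (intro exI[of _ w]) auto
qed

lemma weak_gradient_representative:
  fixes u :: "'a::euclidean_space \<Rightarrow> real"
  assumes \<Omega>: "open \<Omega>" "bounded \<Omega>" and u: "square_integrable \<Omega> u" and Du: "L2_weak_gradient \<Omega> u Du"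
  shows "\<exists>v G. integrable_weak_gradient \<Omega> v G \<and>
    integrable lborel (\<lambda>x. (v x)\<^sup>2) \<and> integrable lborel (\<lambda>x. (norm (G x))\<^sup>2) \<and> (\<forall>x. x \<notin> \<Omega> \<longrightarrow> v x = 0) \<and>
    (LINT x|lebesgue_on \<Omega>. u x) = (LINT x|lborel. v x) \<and>
    (LINT x|lebesgue_on \<Omega>. (u x)\<^sup>2) = (LINT x|lborel. (v x)\<^sup>2) \<and>
    (LINT x|lebesgue_on \<Omega>. (norm (Du x))\<^sup>2) = (LINT x|lborel. (norm (G x))\<^sup>2)"
proof -
  have B: "\<Omega> \<in> sets borel" using \<Omega> by auto
  have sDu: "square_integrable \<Omega> Du"
    and weak: "\<And>\<phi> b. test_function \<Omega> \<phi> \<Longrightarrow> b \<in> Basis \<Longrightarrow>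
        (LINT x|lebesgue_on \<Omega>. u x * partial_deriv b \<phi> x) = - (LINT x|lebesgue_on \<Omega>. (Du x \<bullet> b) * \<phi> x)"
    using Du by (auto simp: L2_weak_gradient_def)
  have um [measurable]: "u \<in> borel_measurable (lebesgue_on \<Omega>)" and gm [measurable]: "Du \<in> borel_measurable (lebesgue_on \<Omega>)"
    using u sDu by (auto simp: square_integrable_def)
  obtain v where v: "integrable lborel v" "integrable lborel (\<lambda>x. (norm (v x))\<^sup>2)" "\<And>x. x \<notin> \<Omega> \<Longrightarrow> v x = 0"
    "AE x in lborel. x \<in> \<Omega> \<longrightarrow> v x = u x"
    "(LINT x|lebesgue_on \<Omega>. (norm (u x))\<^sup>2) = (LINT x|lborel. (norm (v x))\<^sup>2)"
    using square_integrable_representative[OF \<Omega> u] by blast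
  obtain G where G: "integrable lborel G" "integrable lborel (\<lambda>x. (norm (G x))\<^sup>2)" "\<And>x. x \<notin> \<Omega> \<Longrightarrow> G x = 0"
    "AE x in lborel. x \<in> \<Omega> \<longrightarrow> G x = Du x"
    "(LINT x|lebesgue_on \<Omega>. (norm (Du x))\<^sup>2) = (LINT x|lborel. (norm (G x))\<^sup>2)"
    using square_integrable_representative[OF \<Omega> sDu] by blast
  have [measurable]: "v \<in> borel_measurable borel" "G \<in> borel_measurable borel" using v G by auto
  have to_lebesgue: "k \<in> borel_measurable (lebesgue_on \<Omega>)" if "k \<in> borel_measurable borel" for k :: "'a \<Rightarrow> real"
    using that by (intro measurable_restrict_space1 measurable_completion) simp
  have "(LINT y|lborel. v y * partial_deriv b \<phi> y) = - (LINT y|lborel. (G y \<bullet> b) * \<phi> y)"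
    if b: "b \<in> Basis" and \<phi>: "test_function \<Omega> \<phi>" for b \<phi>
  proof -
    have "C_k 1 \<phi>" using \<phi> by (simp add: test_function_def)
    then have "continuous_on UNIV (partial_deriv b \<phi>)" "continuous_on UNIV \<phi>"
      using b C_k_Suc_imp[of 0 \<phi>] by auto
    then have [measurable]: "partial_deriv b \<phi> \<in> borel_measurable borel" "\<phi> \<in> borel_measurable borel"
      by (auto intro: borel_measurable_continuous_onI)
    note [measurable] = to_lebesgue[of "partial_deriv b \<phi>"] to_lebesgue[of \<phi>]
    have "(LINT x|lebesgue_on \<Omega>. u x * partial_deriv b \<phi> x) = (LINT y|lborel. v y * partial_deriv b \<phi> y)"
      using v(4) by (intro integral_lebesgue_on_eq_lborel(1)[OF B]) (auto simp: v(3))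
    moreover have "(LINT x|lebesgue_on \<Omega>. (Du x \<bullet> b) * \<phi> x) = (LINT y|lborel. (G y \<bullet> b) * \<phi> y)"
      using G(4) by (intro integral_lebesgue_on_eq_lborel(1)[OF B]) (auto simp: G(3))
    ultimately show ?thesis using weak[OF \<phi> b] by simp
  qed
  then have "integrable_weak_gradient \<Omega> v G"
    using v(1) G(1) by (simp add: integrable_weak_gradient_def)
  moreover have "(LINT x|lebesgue_on \<Omega>. u x) = (LINT x|lborel. v x)"
    using v(4) by (intro integral_lebesgue_on_eq_lborel(1)[OF B]) (auto simp: v(3))
  ultimately show ?thesis
    using v G by (intro exI[of _ v] exI[of _ G]) auto
qed

section \<open>The Poincare inequality\<close>

text \<open>
  For small \<open>\<epsilon>\<close> the estimate holds for the averages over the cubes of side \<open>\<epsilon>\<close> at \<open>x\<close> and \<open>y\<close>, with a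
  right-hand side independent of \<open>\<epsilon>\<close>; for almost all \<open>x\<close> and \<open>y\<close> these averages converge to \<open>v x\<close> and \<open>v y\<close>.
\<close>

lemma two_point_estimate:
  fixes \<Omega> :: "'a::euclidean_space set"
  assumes ud: "uniform_domain M \<Omega>" and sub: "\<Omega> \<subseteq> ball 0 R" and v: "integrable lborel v"
    and bound: "\<And>x y S p0 r0 p1 r1. connected S \<Longrightarrow>
     (\<forall>(p, r)\<in>S. 0 < r \<and> r \<le> 2 * R + 1 \<and> ball p (4 * real DIM('a) * r) \<subseteq> \<Omega> \<and>
       (norm (p - x) \<le> 2 * M * (4 * real DIM('a)) * r \<or> norm (p - y) \<le> 2 * M * (4 * real DIM('a)) * r)) \<Longrightarrow>
     (p0, r0) \<in> S \<Longrightarrow> (p1, r1) \<in> S \<Longrightarrow>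
     ennreal \<bar>mollify v p0 r0 - mollify v p1 r1\<bar> \<le> H x + H y"
  shows "AE x in restrict_space lborel \<Omega>. AE y in restrict_space lborel \<Omega>. ennreal \<bar>v x - v y\<bar> \<le> H x + H y"
proof -
  have op: "open \<Omega>" using ud by (auto simp: uniform_domain_def is_domain_def)
  have n1: "1 \<le> 4 * real DIM('a)"
    using DIM_positive[where 'a='a] by linarith
  have lim: "AE x in restrict_space lborel \<Omega>. x \<in> \<Omega> \<and> ((\<lambda>r. mollify v x r) \<longlongrightarrow> v x) (at_right 0)"
    using mollify_tendsto_AE[OF v] op by (subst AE_restrict_space_iff) auto
  show ?thesis
    using lim
  proof eventually_elim
    fix x assume x: "x \<in> \<Omega> \<and> ((\<lambda>r. mollify v x r) \<longlongrightarrow> v x) (at_right 0)"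
    show "AE y in restrict_space lborel \<Omega>. ennreal \<bar>v x - v y\<bar> \<le> H x + H y"
      using lim
    proof eventually_elim
      fix y assume y: "y \<in> \<Omega> \<and> ((\<lambda>r. mollify v y r) \<longlongrightarrow> v y) (at_right 0)"
      obtain \<epsilon>0 where \<epsilon>0: "\<epsilon>0 > 0" "\<And>\<epsilon>. 0 < \<epsilon> \<Longrightarrow> \<epsilon> < \<epsilon>0 \<Longrightarrow> (\<exists>S. connected S \<and> (x, \<epsilon>) \<in> S \<and> (y, \<epsilon>) \<in> S \<and>
        (\<forall>(p, r)\<in>S. 0 < r \<and> r \<le> 2 * R + 1 \<and> ball p (4 * real DIM('a) * r) \<subseteq> \<Omega> \<and>
        (norm (p - x) \<le> 2 * M * (4 * real DIM('a)) * r \<or> norm (p - y) \<le> 2 * M * (4 * real DIM('a)) * r)))"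
        using uniform_domain_connected_family[OF ud sub n1, of x y] x y by meson
      have "((\<lambda>r. ennreal \<bar>mollify v x r - mollify v y r\<bar>) \<longlongrightarrow> ennreal \<bar>v x - v y\<bar>) (at_right 0)"
        using x y by (intro tendsto_ennrealI tendsto_rabs tendsto_diff) auto
      moreover have "\<forall>\<^sub>F r in at_right 0. ennreal \<bar>mollify v x r - mollify v y r\<bar> \<le> H x + H y"
        unfolding eventually_at_right_field
      proof (intro exI[of _ \<epsilon>0] conjI allI impI \<epsilon>0(1))
        fix \<epsilon> :: real assume "0 < \<epsilon>" "\<epsilon> < \<epsilon>0"
        from \<epsilon>0(2)[OF this] obtain S where S: "connected S" "(x, \<epsilon>) \<in> S" "(y, \<epsilon>) \<in> S"
          "\<forall>(p, r)\<in>S. 0 < r \<and> r \<le> 2 * R + 1 \<and> ball p (4 * real DIM('a) * r) \<subseteq> \<Omega> \<and>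
          (norm (p - x) \<le> 2 * M * (4 * real DIM('a)) * r \<or> norm (p - y) \<le> 2 * M * (4 * real DIM('a)) * r)"
          by blast
        show "ennreal \<bar>mollify v x \<epsilon> - mollify v y \<epsilon>\<bar> \<le> H x + H y"
          by (rule bound[OF S(1,4,2,3)])
      qed
      ultimately show "ennreal \<bar>v x - v y\<bar> \<le> H x + H y"
        by (intro tendsto_upperbound[where F="at_right 0"]) auto
    qed
  qed
qed

theorem theorem4p1:
  fixes M R :: real
  assumes "M > 1" and "R > 0"
  shows "\<exists>C>0. \<forall>\<Omega> :: (real ^ 'n) set. uniform_domain M \<Omega> \<and> \<Omega> \<subseteq> ball 0 R \<longrightarrow>
           (\<forall>u \<in> H1 \<Omega>. \<forall>Du. L2_weak_gradient \<Omega> u Du \<and> (LINT x|lebesgue_on \<Omega>. u x) = 0 \<longrightarrow>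
              (LINT x|lebesgue_on \<Omega>. (u x)\<^sup>2) \<le> C * (LINT x|lebesgue_on \<Omega>. (norm (Du x))\<^sup>2))"
proof -
  \<comment> \<open>\<open>D\<close> and \<open>A\<close> are the constants of
    \<open>uniform_domain_connected_family\<close> for \<open>N = 4 * n\<close>, the room that
    \<open>mollify_difference_bound\<close> requires around each cube.\<close>
  define D where "D = 2 * R + 1"
  define A where "A = 2 * M * (4 * real DIM(real ^ 'n))"
  define a where "a = \<bar>A\<bar> + 4 * real DIM(real ^ 'n)"
  have D: "0 < D" using assms by (simp add: D_def)
  have a: "0 \<le> a" by (simp add: a_def)
  obtain c where c: "c \<ge> 0" and diff: "\<forall>\<Omega> v G (x::real ^ 'n) y (S :: ((real ^ 'n) \<times> real) set) p0 r0 p1 r1.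
     integrable_weak_gradient \<Omega> v G \<longrightarrow> connected S \<longrightarrow>
     (\<forall>(p, r)\<in>S. 0 < r \<and> r \<le> D \<and> ball p (4 * real DIM(real ^ 'n) * r) \<subseteq> \<Omega> \<and> (norm (p - x) \<le> A * r \<or> norm (p - y) \<le> A * r)) \<longrightarrow>
     (p0, r0) \<in> S \<longrightarrow> (p1, r1) \<in> S \<longrightarrow>
     ennreal \<bar>mollify v p0 r0 - mollify v p1 r1\<bar> \<le> riesz_potential c a D G x + riesz_potential c a D G y"
    using mollify_difference_bound[OF D, where 'a="real ^ 'n" and A=A] unfolding a_def by blast
  define K where "K = enn2real (\<integral>\<^sup>+z. riesz_kernel c a D (z :: real ^ 'n) \<partial>lborel)"
  have K: "ennreal K = (\<integral>\<^sup>+z. riesz_kernel c a D (z :: real ^ 'n) \<partial>lborel)" "0 \<le> K"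
    using nn_integral_riesz_kernel_finite[OF c a D, where 'a="real ^ 'n"] by (simp_all add: K_def)
  show ?thesis
  proof (intro exI[of _ "4 * K\<^sup>2 + 1"] conjI allI ballI impI; (elim conjE)?)
    \<comment> \<open>The summand 1 makes the constant positive also when \<open>K = 0\<close>.\<close>
    show "0 < 4 * K\<^sup>2 + 1" by (simp add: add_nonneg_pos)
    fix \<Omega> :: "(real ^ 'n) set" and u Du
    assume ud: "uniform_domain M \<Omega>" and sub: "\<Omega> \<subseteq> ball 0 R" and u: "u \<in> H1 \<Omega>"
      and Du: "L2_weak_gradient \<Omega> u Du" and mean: "(LINT x|lebesgue_on \<Omega>. u x) = 0"
    have \<Omega>: "open \<Omega>" "bounded \<Omega>" "\<Omega> \<noteq> {}"
      using ud sub bounded_subset[OF bounded_ball] by (auto simp: uniform_domain_def is_domain_def)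
    have "square_integrable \<Omega> u" using u by (simp add: H1_def)
    from weak_gradient_representative[OF \<Omega>(1,2) this Du] obtain v G where
      wg: "integrable_weak_gradient \<Omega> v G"
      and v2: "integrable lborel (\<lambda>x. (v x)\<^sup>2)" and G2: "integrable lborel (\<lambda>x. (norm (G x))\<^sup>2)"
      and v0: "\<And>x. x \<notin> \<Omega> \<Longrightarrow> v x = 0"
      and eqs: "(LINT x|lebesgue_on \<Omega>. u x) = (LINT x|lborel. v x)"
        "(LINT x|lebesgue_on \<Omega>. (u x)\<^sup>2) = (LINT x|lborel. (v x)\<^sup>2)"
        "(LINT x|lebesgue_on \<Omega>. (norm (Du x))\<^sup>2) = (LINT x|lborel. (norm (G x))\<^sup>2)"
      by blast
    have v: "integrable lborel v" and G [measurable]: "G \<in> borel_measurable borel"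
      using wg by (auto simp: integrable_weak_gradient_def)
    define H where "H = riesz_potential c a D G"
    have [measurable]: "H \<in> borel_measurable borel" unfolding H_def by measurable
    let ?N = "restrict_space lborel \<Omega>"
    have \<Omega>s: "\<Omega> \<inter> space lborel \<in> sets lborel" using \<Omega> by auto
    have \<mu>: "emeasure ?N (space ?N) = emeasure lborel \<Omega>"
      using \<Omega> by (simp add: space_restrict_space emeasure_restrict_space)
    have fin: "finite_measure ?N"
      using emeasure_bounded_finite[OF \<Omega>(2)] by (intro finite_measureI) (simp add: \<mu>)
    have nz: "emeasure ?N (space ?N) \<noteq> 0"
    proof
      assume "emeasure ?N (space ?N) = 0"
      then have "\<Omega> \<in> null_sets lborel" using \<Omega> \<mu> by (auto simp: null_sets_def)
      then have "negligible \<Omega>" by (simp add: negligible_iff_null_sets null_sets_completionI)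
      then show False using open_not_negligible \<Omega> by blast
    qed
    have ext: "indicator \<Omega> x *\<^sub>R v x = v x" for x using v0[of x] by (auto simp: indicator_def)
    have vN: "integrable ?N v" "(LINT x|?N. v x) = 0"
      using v mean eqs(1) by (simp_all only: integrable_restrict_space[OF \<Omega>s] integral_restrict_space[OF \<Omega>s] ext)
    have two: "AE x in ?N. AE y in ?N. ennreal \<bar>v x - v y\<bar> \<le> H x + H y"
      using diff wg unfolding H_def A_def D_def
      by (intro two_point_estimate[OF ud sub v]) blast
    have "ennreal (LINT x|lborel. (v x)\<^sup>2) = (\<integral>\<^sup>+x. ennreal ((v x)\<^sup>2) \<partial>lborel)"
      using nn_integral_eq_integral[OF v2] by simp
    also have "\<dots> = (\<integral>\<^sup>+x. ennreal ((v x)\<^sup>2) \<partial>?N)"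
      unfolding nn_integral_restrict_space[OF \<Omega>s]
      by (intro nn_integral_cong) (use v0 in \<open>auto simp: indicator_def\<close>)
    also have "\<dots> \<le> 4 * (\<integral>\<^sup>+x. (H x)\<^sup>2 \<partial>?N)"
      by (rule mean_zero_L2_bound[OF fin nz vN _ two]) (auto intro: measurable_restrict_space1)
    also have "\<dots> \<le> 4 * (\<integral>\<^sup>+x. (H x)\<^sup>2 \<partial>lborel)"
      unfolding nn_integral_restrict_space[OF \<Omega>s]
      by (intro mult_left_mono nn_integral_mono) (auto simp: indicator_def)
    also have "\<dots> \<le> 4 * ((ennreal K)\<^sup>2 * (\<integral>\<^sup>+y. (ennreal (norm (G y)))\<^sup>2 \<partial>lborel))"
      unfolding H_def riesz_potential_def K(1)
      by (intro mult_left_mono young_convolution_L1_L2) auto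
    also have "(\<integral>\<^sup>+y. (ennreal (norm (G y)))\<^sup>2 \<partial>lborel) = ennreal (LINT x|lborel. (norm (G x))\<^sup>2)"
      using nn_integral_eq_integral[OF G2] by (simp add: ennreal_power)
    also have "4 * ((ennreal K)\<^sup>2 * ennreal (LINT x|lborel. (norm (G x))\<^sup>2)) = ennreal (4 * (K\<^sup>2 * (LINT x|lborel. (norm (G x))\<^sup>2)))"
      using K(2) by (simp add: ennreal_mult ennreal_power)
    finally have "(LINT x|lborel. (v x)\<^sup>2) \<le> 4 * (K\<^sup>2 * (LINT x|lborel. (norm (G x))\<^sup>2))"
      by (subst (asm) ennreal_le_iff) auto
    also have "\<dots> \<le> (4 * K\<^sup>2 + 1) * (LINT x|lborel. (norm (G x))\<^sup>2)"
      by (simp add: algebra_simps)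
    finally show "(LINT x|lebesgue_on \<Omega>. (u x)\<^sup>2) \<le> (4 * K\<^sup>2 + 1) * (LINT x|lebesgue_on \<Omega>. (norm (Du x))\<^sup>2)"
      by (simp add: eqs)
  qed
qed

end
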